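(* Let $\Sigma$ be the normal fan of a convex $n$-gon in $\mathbb{R}^2$ with ray matrix $U\in\mathbb{R}^{n\times 2}$, whose rows are ordered such that the $n$ maximal cones of $\Sigma$ are generated by the pairs of rows indexed by $12,23,34,\ldots,(n-1)n,1n$. Let $u_{ij}=|\det U_{ij}|$, where $U_{ij}$ is the $2\times2$ submatrix of $U$ with rows $i,j$. If $n$ is not a multiple of $4$ or $u_{12}u_{34}\cdots u_{n-1,n}\neq u_{1n}u_{23}\cdots u_{n-2,n-1}$, then Warren's adjoint curve $\{y\in\mathbb{C}^2:{\rm adj}_{P_z}(y)=0\}$ of the polygon $P_z=\{y\in\mathbb{R}^2:Uy+z\ge0\}$ is smooth for generic $z\in{\rm Def}(\Sigma)$.
   Context: The normal fan is the inner normal fan, with $n$ rays. A ray matrix $U$ has rows $u_1,\dots,u_n$, nonzero generators of the rays of $\Sigma$. The deformation cone ${\rm Def}(\Sigma)\subset\mathbb{R}^n$ is the $n$-dimensional closed cone of those $z$ such that the piecewise linear function $\phi:\mathbb{R}^2\to\mathbb{R}$ which is linear on each cone of $\Sigma$ and satisfies $\phi(u_i)=z_i$ is convex; its interior is the set of $z\in\mathbb{R}^n$ for which the normal fan of $P_z$ equals $\Sigma$. Warren's adjoint: for $z\in{\rm int}({\rm Def}(\Sigma))$, ${\rm adj}_{P_z}(y)$ is the polynomial in $y_1,y_2$ determined by $${\rm Vol}\big((P_z-y)^\circ\big)=\frac{{\rm adj}_{P_z}(y)}{\prod_{i=1}^n(u_i\cdot y+z_i)}\qquad\text{for all }y\in{\rm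 int}(P_z),$$ where $P_z-y$ is the translate, $K^\circ=\{u\in(\mathbb{R}^2)^\vee:u\cdot y'\ge-1\ \text{for all }y'\in K\}$ is the polar dual, and ${\rm Vol}$ is $2!$ times the area. "Generic $z\in{\rm Def}(\Sigma)$" means $z$ in ${\rm Def}(\Sigma)$ outside a proper Zariski-closed subset of $\mathbb{R}^n$ (which may be taken to contain the boundary of ${\rm Def}(\Sigma)$). Smooth means that ${\rm adj}_{P_z}$ and its first partial derivatives have no common zero in $\mathbb{C}^2$. *)

theory Defs
  imports "HOL-Analysis.Analysis" "HOL-Computational_Algebra.Polynomial"
begin

section \<open>Polygons, fans and deformation cones\<close>

definition convex_gon :: "nat \<Rightarrow> (real^2) set \<Rightarrow> bool" where
  "convex_gon n Q \<longleftrightarrow> polytope Q \<and> aff_dim Q = 2 \<and> card {v. v extreme_point_of Q} = n"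

definition inner_normal_cone :: "(real^2) set \<Rightarrow> (real^2) set \<Rightarrow> (real^2) set" where
  "inner_normal_cone Q F = {u. \<forall>x\<in>F. \<forall>y\<in>Q. u \<bullet> x \<le> u \<bullet> y}"

definition normal_fan :: "(real^2) set \<Rightarrow> (real^2) set set" where
  "normal_fan Q = {inner_normal_cone Q F | F. F face_of Q \<and> F \<noteq> {}}"

definition maximal_cones :: "(real^2) set set \<Rightarrow> (real^2) set set" where
  "maximal_cones \<Sigma> = {C \<in> \<Sigma>. \<forall>D\<in>\<Sigma>. C \<subseteq> D \<longrightarrow> C = D}"

text \<open>The rays of a fan are its one-dimensional cones; each of them has exactly one generator
  among the rows of a ray matrix.\<close>

definition ray_matrix :: "(real^2) set set \<Rightarrow> real^2^'n \<Rightarrow> bool" where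
  "ray_matrix \<Sigma> U \<longleftrightarrow>
     (\<forall>i. U $ i \<noteq> 0) \<and>
     bij_betw (\<lambda>i. convex_cone hull {U $ i}) UNIV {C \<in> \<Sigma>. aff_dim C = 1}"

text \<open>The rows of a matrix are indexed by a finite type, and an ordering of them is an
  enumeration \<open>r 1, \<dots>, r n\<close> of that type.\<close>

definition cyclic_order :: "(real^2) set set \<Rightarrow> real^2^'n \<Rightarrow> (nat \<Rightarrow> 'n) \<Rightarrow> bool" where
  "cyclic_order \<Sigma> U r \<longleftrightarrow>
     bij_betw r {1..CARD('n)} UNIV \<and>
     maximal_cones \<Sigma> =
       {convex_cone hull {U $ r i, U $ r (i + 1)} | i. i \<in> {1..<CARD('n)}}
         \<union> {convex_cone hull {U $ r 1, U $ r CARD('n)}}"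

definition Def_cone :: "(real^2) set set \<Rightarrow> real^2^'n \<Rightarrow> (real^'n) set" where
  "Def_cone \<Sigma> U =
     {z. \<exists>\<phi> :: real^2 \<Rightarrow> real.
           (\<forall>C\<in>\<Sigma>. \<exists>L. linear L \<and> (\<forall>x\<in>C. \<phi> x = L x)) \<and>
           (\<forall>i. \<phi> (U $ i) = z $ i) \<and>
           convex_on UNIV \<phi>}"

definition polygon :: "real^2^'n \<Rightarrow> real^'n \<Rightarrow> (real^2) set" where
  "polygon U z = {y. 0 \<le> U *v y + z}"

definition minor :: "real^2^'n \<Rightarrow> 'n \<Rightarrow> 'n \<Rightarrow> real" where
  "minor U i j = \<bar>det (vector [U $ i, U $ j] :: real^2^2)\<bar>"


section \<open>Warren's adjoint\<close>

definition polar_dual :: "(real^2) set \<Rightarrow> (real^2) set" where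
  "polar_dual K = {u. \<forall>y\<in>K. u \<bullet> y \<ge> -1}"

definition Vol :: "(real^2) set \<Rightarrow> real" where
  "Vol K = fact 2 * measure lebesgue K"

text \<open>A polynomial in \<open>y\<^sub>1, y\<^sub>2\<close> is a univariate polynomial in \<open>y\<^sub>2\<close> whose coefficients are
  polynomials in \<open>y\<^sub>1\<close>.\<close>

definition eval2 :: "'a::comm_ring_1 poly poly \<Rightarrow> 'a^2 \<Rightarrow> 'a" where
  "eval2 p y = poly (poly p [:y $ 2:]) (y $ 1)"

definition partial1 :: "'a::idom poly poly \<Rightarrow> 'a poly poly" where
  "partial1 p = map_poly pderiv p"

definition partial2 :: "'a::idom poly poly \<Rightarrow> 'a poly poly" where
  "partial2 p = pderiv p"

definition complexify :: "real poly poly \<Rightarrow> complex poly poly" where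
  "complexify p = map_poly (map_poly complex_of_real) p"

text \<open>To be used only for \<open>z\<close> in the interior of the deformation cone: there \<open>polygon U z\<close> is
  bounded with non-empty interior, so the polynomial below exists and is unique.\<close>

definition adjoint_poly :: "real^2^'n \<Rightarrow> real^'n \<Rightarrow> real poly poly" where
  "adjoint_poly U z =
     (THE p. \<forall>y \<in> interior (polygon U z).
        Vol (polar_dual ((\<lambda>x. x - y) ` polygon U z)) =
          eval2 p y / (\<Prod>i\<in>UNIV. U $ i \<bullet> y + z $ i))"

definition smooth_curve :: "real poly poly \<Rightarrow> bool" where
  "smooth_curve p \<longleftrightarrow>
     \<not> (\<exists>y :: complex^2.
           eval2 (complexify p) y = 0 \<and>
           eval2 (partial1 (complexify p)) y = 0 \<and>
           eval2 (partial2 (complexify p)) y = 0)"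


section \<open>Genericity\<close>

definition zariski_closed :: "(real^'n) set \<Rightarrow> bool" where
  "zariski_closed Z \<longleftrightarrow>
     (\<exists>F. (\<forall>f\<in>F. real_polynomial_function f) \<and> Z = {z. \<forall>f\<in>F. f z = 0})"

text \<open>The exceptional set contains the boundary, so that only interior points, where
  the adjoint is defined, are generic.\<close>

definition generic_in_Def ::
    "(real^2) set set \<Rightarrow> real^2^'n \<Rightarrow> (real^'n \<Rightarrow> bool) \<Rightarrow> bool" where
  "generic_in_Def \<Sigma> U P \<longleftrightarrow>
     (\<exists>Z. zariski_closed Z \<and> Z \<noteq> UNIV \<and> frontier (Def_cone \<Sigma> U) \<subseteq> Z \<and>
          (\<forall>z \<in> Def_cone \<Sigma> U - Z. P z))"

end

theory Submission
  imports Defs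
begin

text \<open>
  Write \<open>m\<^sub>i\<close> for the minor of the rows \<open>i\<close> and \<open>i + 1\<close> and put \<open>x = U y + z\<close>. Triangulating the
  polar dual from the origin shows that the adjoint is \<open>B (U y + z)\<close> with
  \<open>B(x) = \<Sum>\<^sub>i m\<^sub>i \<Prod>\<^bsub>j \<noteq> i, i+1\<^esub> x\<^sub>j\<close>, so the curve is the section of the hypersurface \<open>B = 0\<close> by a
  translate of a fixed plane. At a generic translate the section is smooth wherever it meets the
  smooth locus of \<open>B\<close> (Bertini), so it remains to see that a generic translate misses the singular
  locus of \<open>B\<close>. In the torus \<open>B\<close> is, up to a unit, the quadratic form \<open>\<Sum>\<^sub>i m\<^sub>i w\<^sub>i w\<^bsub>i+1\<^esub>\<close> in
  \<open>w = 1/x\<close>, which is degenerate exactly when the hypothesis on \<open>n\<close> and the minors fails. Outside the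
  torus the singular points lie on finitely many linear subspaces of codimension three, which a
  generic translate of a plane avoids.
\<close>

section \<open>Extension of derivations\<close>

text \<open>The exceptional z form the projection of an algebraic set along y, and it must be shown
  that this projection is not Zariski dense. Elimination of y is avoided: on a dense projection
  there is an ultrafilter along which no nonzero real polynomial in z vanishes, so functions modulo
  the ultrafilter form a field containing the polynomials. Any choice of a singular point y(z),
  however irregular, is a pair of elements of this field, and d/dz_i extends to both: freely at a
  transcendental element, by implicit differentiation at an algebraic one. Thus y(z) acquires
  derivatives without any analytic regularity. Since every coordinate of z varies, every partial
  derivative of B is reached. Codimension three is what is needed because three linear forms become
  dependent on a plane. The number 4 comes from the kernel relation
  \<open>m (\<sigma> i) * w (\<sigma> (\<sigma> i)) = - (m i * w i)\<close>: it moves by two steps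
  and changes the sign, so for even n each parity class of n/2 indices closes up with sign
  (-1)^(n/2), while for odd n all n indices close up with sign -1.\<close>

definition ultra :: "'x filter \<Rightarrow> bool" where
  "ultra F \<longleftrightarrow> F \<noteq> bot \<and> (\<forall>P. eventually P F \<or> eventually (\<lambda>x. \<not> P x) F)"

text \<open>Zorn's lemma for proper filters in the reversed order: a chain is a filter base, so its
  infimum is proper. A minimal proper filter decides every predicate, because restricting it to the
  predicate gives bot or changes nothing.\<close>

lemma ultra_exists:
  fixes F :: "'x filter"
  assumes "F \<noteq> bot"
  shows "\<exists>G\<le>F. ultra G"
proof -
  let ?A = "{G. G \<noteq> bot \<and> G \<le> F}"
  have "\<exists>m\<in>?A. \<forall>a\<in>?A. a \<le> m \<longrightarrow> m = a"
  proof -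
    have "\<exists>m\<in>?A. \<forall>a\<in>?A. (\<lambda>x y. y \<le> x) m a \<longrightarrow> a = m"
    proof (rule predicate_Zorn)
      show "partial_order_on ?A (relation_of (\<lambda>x y. y \<le> x) ?A)"
        by (auto simp: partial_order_on_def preorder_on_def refl_on_def trans_def antisym_def
            relation_of_def)
    next
      fix C assume C: "C \<in> Chains (relation_of (\<lambda>x y. y \<le> x) ?A)"
      show "\<exists>u\<in>?A. \<forall>a\<in>C. u \<le> a"
      proof (cases "C = {}")
        case True
        then show ?thesis using assms by auto
      next
        case False
        have sub: "C \<subseteq> ?A" and tot: "\<And>a b. a \<in> C \<Longrightarrow> b \<in> C \<Longrightarrow> a \<le> b \<or> b \<le> a"
          using C by (auto simp: Chains_def relation_of_def)
        have base: "\<exists>x\<in>C. x \<le> inf a b" if "a \<in> C" "b \<in> C" for a b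
          using tot[OF that] that by (auto intro: bexI[of _ a] bexI[of _ b])
        have "Inf C \<noteq> bot"
          unfolding trivial_limit_def using sub
          by (subst eventually_Inf_base[OF False base]) (auto simp: trivial_limit_def)
        moreover have "Inf C \<le> F" 
        proof -
          obtain a where "a \<in> C" using False by blast
          then show ?thesis using sub Inf_lower[of a C] by (auto intro: order_trans)
        qed
        moreover have "\<forall>a\<in>C. Inf C \<le> a" by (simp add: Inf_lower)
        ultimately show ?thesis by blast
      qed
    qed
    then show ?thesis by auto
  qed
  then obtain G where G: "G \<noteq> bot" "G \<le> F"
    and max: "\<And>H. H \<noteq> bot \<Longrightarrow> H \<le> F \<Longrightarrow> H \<le> G \<Longrightarrow> G = H" by auto
  have "eventually P G \<or> eventually (\<lambda>x. \<not> P x) G" for P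
  proof (cases "inf G (principal {x. P x}) = bot")
    case True
    then show ?thesis
      by (simp add: trivial_limit_def eventually_inf_principal)
  next
    case False
    have "G = inf G (principal {x. P x})"
      by (rule max[OF False]) (use G in \<open>auto intro: le_infI1\<close>)
    then have "G \<le> principal {x. P x}" by (metis inf.cobounded2)
    then show ?thesis by (simp add: le_principal)
  qed
  with G show ?thesis by (auto simp: ultra_def)
qed

lemma ultra_not: "ultra F \<Longrightarrow> \<not> eventually P F \<longleftrightarrow> eventually (\<lambda>x. \<not> P x) F"
proof
  assume "ultra F" "eventually (\<lambda>x. \<not> P x) F"
  moreover have False if "eventually P F" "eventually (\<lambda>x. \<not> P x) F"
    using eventually_elim2[OF that, of "\<lambda>_. False"] \<open>ultra F\<close> by (auto simp: ultra_def)
  ultimately show "\<not> eventually P F" by blast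
qed (auto simp: ultra_def)

text \<open>An ultrafilter is prime. This replaces a choice among finitely many degrees or linear
  forms, made separately at each point, by a single one.\<close>

lemma ultra_finite_disj:
  assumes "ultra F" "finite I" "eventually (\<lambda>x. \<exists>i\<in>I. P i x) F"
  shows "\<exists>i\<in>I. eventually (P i) F"
proof (rule ccontr)
  assume "\<not> ?thesis"
  then have "\<forall>i\<in>I. eventually (\<lambda>x. \<not> P i x) F" using ultra_not[OF assms(1)] by blast
  then have "eventually (\<lambda>x. \<forall>i\<in>I. \<not> P i x) F" by (simp add: assms(2) eventually_ball_finite)
  then have "eventually (\<lambda>x. \<not> (\<exists>i\<in>I. P i x)) F" by simp
  with assms(3) ultra_not[OF assms(1), of "\<lambda>x. \<exists>i\<in>I. P i x"] show False by blast
qed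

text \<open>Graphs of derivations. Functions are read modulo the ultrafilter, so that they form a field,
  and \<open>(a, a')\<close> belongs to the graph when \<open>a'\<close> is the derivative of \<open>a\<close>; the last clause makes the
  derivative well defined.\<close>

definition derivation_graph :: "'x filter \<Rightarrow> (('x \<Rightarrow> complex) \<times> ('x \<Rightarrow> complex)) set \<Rightarrow> bool" where
  "derivation_graph F S \<longleftrightarrow>
     (\<forall>c. (\<lambda>_. c, \<lambda>_. 0) \<in> S) \<and>
     (\<forall>a a' b b'. (a, a') \<in> S \<longrightarrow> (b, b') \<in> S \<longrightarrow>
        (\<lambda>x. a x + b x, \<lambda>x. a' x + b' x) \<in> S \<and>
        (\<lambda>x. a x * b x, \<lambda>x. a x * b' x + a' x * b x) \<in> S) \<and>
     (\<forall>a a'. (a, a') \<in> S \<longrightarrow> (\<forall>\<^sub>F x in F. a x = 0) \<longrightarrow> (\<forall>\<^sub>F x in F. a' x = 0))"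

lemma derivation_graph_const: "derivation_graph F S \<Longrightarrow> (\<lambda>_. c, \<lambda>_. 0) \<in> S"
  by (auto simp: derivation_graph_def)

lemma derivation_graph_add:
  "derivation_graph F S \<Longrightarrow> (a, a') \<in> S \<Longrightarrow> (b, b') \<in> S \<Longrightarrow>
    (\<lambda>x. a x + b x, \<lambda>x. a' x + b' x) \<in> S"
  by (auto simp: derivation_graph_def)

lemma derivation_graph_mult:
  "derivation_graph F S \<Longrightarrow> (a, a') \<in> S \<Longrightarrow> (b, b') \<in> S \<Longrightarrow>
    (\<lambda>x. a x * b x, \<lambda>x. a x * b' x + a' x * b x) \<in> S"
  by (auto simp: derivation_graph_def)

lemma derivation_graph_null:
  "derivation_graph F S \<Longrightarrow> (a, a') \<in> S \<Longrightarrow> \<forall>\<^sub>F x in F. a x = 0 \<Longrightarrow> \<forall>\<^sub>F x in F. a' x = 0"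
  unfolding derivation_graph_def by blast

lemma derivation_graph_scale:
  assumes "derivation_graph F S" "(a, a') \<in> S"
  shows "(\<lambda>x. c * a x, \<lambda>x. c * a' x) \<in> S"
  using derivation_graph_mult[OF assms(1) derivation_graph_const[OF assms(1), of c] assms(2)] by simp

lemma derivation_graph_sum:
  assumes "derivation_graph F S" "finite I" "\<And>i. i \<in> I \<Longrightarrow> (a i, a' i) \<in> S"
  shows "(\<lambda>x. \<Sum>i\<in>I. a i x, \<lambda>x. \<Sum>i\<in>I. a' i x) \<in> S"
  using assms(2,3)
proof (induction I)
  case empty
  then show ?case using derivation_graph_const[OF assms(1), of 0] by simp
next
  case (insert i I)
  then show ?case
    using derivation_graph_add[OF assms(1), of "a i" "a' i" "\<lambda>x. \<Sum>i\<in>I. a i x" "\<lambda>x. \<Sum>i\<in>I. a' i x"] by simp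
qed

lemma derivation_graph_prod:
  assumes "derivation_graph F S" "finite I" "\<And>i. i \<in> I \<Longrightarrow> (a i, a' i) \<in> S"
  shows "(\<lambda>x. \<Prod>i\<in>I. a i x, \<lambda>x. \<Sum>k\<in>I. (\<Prod>i\<in>I - {k}. a i x) * a' k x) \<in> S"
  using assms(2,3)
proof (induction I)
  case empty
  then show ?case using derivation_graph_const[OF assms(1), of 1] by simp
next
  case (insert i I)
  have *: "(\<Prod>j\<in>insert i I - {k}. a j x) = a i x * (\<Prod>j\<in>I - {k}. a j x)" if "k \<in> I" for k x
  proof -
    have "insert i I - {k} = insert i (I - {k})" using that insert by auto
    then show ?thesis using insert by simp
  qed
  have "insert i I - {i} = I" using insert by auto
  then have eq1: "(\<Sum>k\<in>insert i I. (\<Prod>j\<in>insert i I - {k}. a j x) * a' k x) =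
    a i x * (\<Sum>k\<in>I. (\<Prod>j\<in>I - {k}. a j x) * a' k x) + a' i x * (\<Prod>j\<in>I. a j x)" for x
    using insert.hyps by (simp add: * sum_distrib_left mult_ac)
  have eq2: "(\<Prod>j\<in>insert i I. a j x) = a i x * (\<Prod>j\<in>I. a j x)" for x
    using insert.hyps by simp
  show ?case
    unfolding eq1 eq2 by (rule derivation_graph_mult[OF assms(1)]) (use insert in auto)
qed

text \<open>The second component is obtained from the first by differentiating the coefficients.\<close>

definition poly_graph ::
    "(('x \<Rightarrow> complex) \<times> ('x \<Rightarrow> complex)) set \<Rightarrow> (('x \<Rightarrow> complex poly) \<times> ('x \<Rightarrow> complex poly)) set" where
  "poly_graph S = {(Q, Q'). (\<forall>k. (\<lambda>x. coeff (Q x) k, \<lambda>x. coeff (Q' x) k) \<in> S) \<and>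
     (\<exists>m. \<forall>x. degree (Q x) \<le> m \<and> degree (Q' x) \<le> m)}"

lemma poly_graph_coeff: "(Q, Q') \<in> poly_graph S \<Longrightarrow> (\<lambda>x. coeff (Q x) k, \<lambda>x. coeff (Q' x) k) \<in> S"
  by (auto simp: poly_graph_def)

lemma poly_graph_const:
  assumes "derivation_graph F S" "(a, a') \<in> S"
  shows "(\<lambda>x. [:a x:], \<lambda>x. [:a' x:]) \<in> poly_graph S"
proof -
  have "(\<lambda>x. coeff [:a x:] k, \<lambda>x. coeff [:a' x:] k) \<in> S" for k
    using assms derivation_graph_const[OF assms(1), of 0] by (cases k) auto
  then show ?thesis by (auto simp: poly_graph_def intro!: exI[of _ 0])
qed

lemma poly_graph_add:
  assumes "derivation_graph F S" "(Q, Q') \<in> poly_graph S" "(R, R') \<in> poly_graph S"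
  shows "(\<lambda>x. Q x + R x, \<lambda>x. Q' x + R' x) \<in> poly_graph S"
proof -
  obtain m1 m2 where "\<forall>x. degree (Q x) \<le> m1 \<and> degree (Q' x) \<le> m1" "\<forall>x. degree (R x) \<le> m2 \<and> degree (R' x) \<le> m2"
    using assms(2,3) by (auto simp: poly_graph_def)
  then have "\<forall>x. degree (Q x + R x) \<le> max m1 m2 \<and> degree (Q' x + R' x) \<le> max m1 m2"
    by (meson degree_add_le le_max_iff_disj)
  then show ?thesis
    using derivation_graph_add[OF assms(1) poly_graph_coeff[OF assms(2)] poly_graph_coeff[OF assms(3)]]
    by (auto simp: poly_graph_def)
qed

lemma poly_graph_mult:
  assumes "derivation_graph F S" "(Q, Q') \<in> poly_graph S" "(R, R') \<in> poly_graph S"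
  shows "(\<lambda>x. Q x * R x, \<lambda>x. Q x * R' x + Q' x * R x) \<in> poly_graph S"
proof -
  obtain m1 m2 where "\<forall>x. degree (Q x) \<le> m1 \<and> degree (Q' x) \<le> m1" "\<forall>x. degree (R x) \<le> m2 \<and> degree (R' x) \<le> m2"
    using assms(2,3) by (auto simp: poly_graph_def)
  then have "\<forall>x. degree (Q x * R x) \<le> m1 + m2 \<and> degree (Q x * R' x + Q' x * R x) \<le> m1 + m2"
    by (meson add_mono degree_add_le degree_mult_le order_trans)
  moreover have "(\<lambda>x. coeff (Q x * R x) k, \<lambda>x. coeff (Q x * R' x + Q' x * R x) k) \<in> S" for k
    using derivation_graph_sum[OF assms(1) finite_atMost[of k]
        derivation_graph_mult[OF assms(1) poly_graph_coeff[OF assms(2)] poly_graph_coeff[OF assms(3)]],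
        of "\<lambda>i. i" "\<lambda>i. k - i"]
    by (simp add: coeff_mult sum.distrib)
  ultimately show ?thesis by (auto simp: poly_graph_def)
qed

lemma poly_graph_pderiv:
  assumes "derivation_graph F S" "(Q, Q') \<in> poly_graph S"
  shows "(\<lambda>x. pderiv (Q x), \<lambda>x. pderiv (Q' x)) \<in> poly_graph S"
proof -
  obtain m where "\<forall>x. degree (Q x) \<le> m \<and> degree (Q' x) \<le> m"
    using assms(2) by (auto simp: poly_graph_def)
  then have "\<forall>x. degree (pderiv (Q x)) \<le> m \<and> degree (pderiv (Q' x)) \<le> m"
    by (auto simp: degree_pderiv intro: le_trans[OF diff_le_self])
  then show ?thesis
    using derivation_graph_scale[OF assms(1) poly_graph_coeff[OF assms(2)]]
    by (auto simp: poly_graph_def coeff_pderiv simp del: of_nat_Suc)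
qed

lemma poly_graph_X: "derivation_graph F S \<Longrightarrow> (\<lambda>x. monom 1 k, \<lambda>x. 0) \<in> poly_graph S"
  using derivation_graph_const[of F S]
  by (auto simp: poly_graph_def intro!: exI[of _ k] degree_monom_le)

text \<open>The derivative of \<open>Q(y)\<close> when \<open>y\<close> has derivative \<open>e\<close>.\<close>

definition adjoin_deriv ::
    "('x \<Rightarrow> complex) \<Rightarrow> ('x \<Rightarrow> complex) \<Rightarrow> ('x \<Rightarrow> complex poly) \<Rightarrow> ('x \<Rightarrow> complex poly) \<Rightarrow> 'x \<Rightarrow> complex" where
  "adjoin_deriv y e Q Q' x = poly (Q' x) (y x) + poly (pderiv (Q x)) (y x) * e x"

lemma adjoin_deriv_mult:
  "adjoin_deriv y e (\<lambda>x. Q x * R x) (\<lambda>x. Q x * R' x + Q' x * R x) x =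
    poly (Q x) (y x) * adjoin_deriv y e R R' x + adjoin_deriv y e Q Q' x * poly (R x) (y x)"
  by (simp add: adjoin_deriv_def pderiv_mult algebra_simps)

lemma adjoin_deriv_add:
  "adjoin_deriv y e (\<lambda>x. Q x + R x) (\<lambda>x. Q' x + R' x) x =
    adjoin_deriv y e Q Q' x + adjoin_deriv y e R R' x"
  by (simp add: adjoin_deriv_def pderiv_add algebra_simps)

text \<open>The degree bound in \<open>poly_graph\<close>, uniform in x, is there for this: only
  finitely many coefficients matter, so their eventual vanishing can be intersected.\<close>

lemma poly_graph_eventually_zero:
  assumes "derivation_graph F S" "(Q, Q') \<in> poly_graph S" "\<forall>\<^sub>F x in F. Q x = 0"
  shows "\<forall>\<^sub>F x in F. adjoin_deriv y e Q Q' x = 0"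
proof -
  obtain m where m: "\<And>x. degree (Q' x) \<le> m"
    using assms(2) by (auto simp: poly_graph_def)
  have "\<forall>\<^sub>F x in F. coeff (Q' x) k = 0" for k
    by (rule derivation_graph_null[OF assms(1) poly_graph_coeff[OF assms(2)]])
      (use assms(3) in \<open>auto elim: eventually_mono\<close>)
  then have "\<forall>\<^sub>F x in F. \<forall>k\<in>{..m}. coeff (Q' x) k = 0"
    by (intro eventually_ball_finite) auto
  then have "\<forall>\<^sub>F x in F. Q' x = 0"
  proof eventually_elim
    case (elim x)
    have "coeff (Q' x) k = 0" for k
      using elim m[of x] by (cases "k \<le> m") (auto intro: coeff_eq_0)
    then show ?case by (simp add: poly_eq_iff)
  qed
  with assms(3) show ?thesis
    by eventually_elim (simp add: adjoin_deriv_def)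
qed

lemma poly_graph_degree:
  assumes "ultra F" "(Q, Q') \<in> poly_graph S"
  obtains m where "\<forall>\<^sub>F x in F. degree (Q x) = m"
proof -
  obtain m where "\<forall>x. degree (Q x) \<le> m"
    using assms(2) by (auto simp: poly_graph_def)
  then have "\<forall>\<^sub>F x in F. \<exists>k\<in>{..m}. degree (Q x) = k" by simp
  from ultra_finite_disj[OF assms(1) _ this] that show ?thesis by auto
qed

text \<open>The derivative \<open>e\<close> of \<open>y\<close> is arbitrary if \<open>y\<close> is transcendental; otherwise it is forced by a
  polynomial of minimal degree vanishing at \<open>y\<close>, which is separable in characteristic 0.\<close>

lemma adjoin_deriv_well_defined:
  assumes F: "ultra F" and S: "derivation_graph F S"
  shows "\<exists>e. \<forall>(Q, Q')\<in>poly_graph S. (\<forall>\<^sub>F x in F. poly (Q x) (y x) = 0) \<longrightarrow>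
      (\<forall>\<^sub>F x in F. adjoin_deriv y e Q Q' x = 0)"
proof -
  define H where "H m \<longleftrightarrow> (\<exists>(Q, Q')\<in>poly_graph S. (\<forall>\<^sub>F x in F. poly (Q x) (y x) = 0) \<and>
      (\<forall>\<^sub>F x in F. Q x \<noteq> 0 \<and> degree (Q x) = m))" for m
  have H: "H m" if "(Q, Q') \<in> poly_graph S" "\<forall>\<^sub>F x in F. poly (Q x) (y x) = 0"
      "\<not> (\<forall>\<^sub>F x in F. Q x = 0)" "\<forall>\<^sub>F x in F. degree (Q x) = m" for Q Q' m
    using that ultra_not[OF F] by (auto simp: H_def eventually_conj_iff intro!: bexI[of _ "(Q, Q')"])
  show ?thesis
  proof (cases "\<exists>m. H m")
    case False
    then have "\<forall>\<^sub>F x in F. Q x = 0" if "(Q, Q') \<in> poly_graph S" "\<forall>\<^sub>F x in F. poly (Q x) (y x) = 0" for Q Q'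
      using H[OF that] poly_graph_degree[OF F that(1)] by blast
    then show ?thesis using poly_graph_eventually_zero[OF S] by blast
  next
    case True
    define m where "m = (LEAST m. H m)"
    have "H m" unfolding m_def using True by (rule LeastI_ex)
    have m_le: "m \<le> k" if "H k" for k unfolding m_def using that by (rule Least_le)
    obtain P P' where P: "(P, P') \<in> poly_graph S" and P0: "\<forall>\<^sub>F x in F. poly (P x) (y x) = 0"
      and Pm: "\<forall>\<^sub>F x in F. P x \<noteq> 0 \<and> degree (P x) = m"
      using \<open>H m\<close> by (auto simp: H_def)
    have "m \<noteq> 0"
    proof
      assume "m = 0"
      from P0 Pm have "\<forall>\<^sub>F x in F. False"
      proof eventually_elim
        case (elim x)
        then obtain c where "P x = [:c:]" using \<open>m = 0\<close> by (auto elim: degree_eq_zeroE)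
        with elim show ?case by simp
      qed
      with F show False by (auto simp: ultra_def)
    qed
    have sep: "\<forall>\<^sub>F x in F. poly (pderiv (P x)) (y x) \<noteq> 0"
    proof (rule ccontr)
      assume "\<not> ?thesis"
      then have "\<forall>\<^sub>F x in F. poly (pderiv (P x)) (y x) = 0"
        using ultra_not[OF F, of "\<lambda>x. poly (pderiv (P x)) (y x) \<noteq> 0"] by simp
      moreover have nz: "\<forall>\<^sub>F x in F. pderiv (P x) \<noteq> 0 \<and> degree (pderiv (P x)) = m - 1"
        using Pm by eventually_elim (use \<open>m \<noteq> 0\<close> in \<open>auto simp: degree_pderiv pderiv_eq_0_iff\<close>)
      ultimately have "H (m - 1)"
        using poly_graph_pderiv[OF S P] by (auto simp: H_def)
      with m_le[of "m - 1"] \<open>m \<noteq> 0\<close> show False by simp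
    qed
    \<comment> \<open>Implicit differentiation of P(y) = 0; by \<open>sep\<close> the denominator is
      nonzero along F.\<close>
    define e where "e x = - poly (P' x) (y x) / poly (pderiv (P x)) (y x)" for x
    have DP: "\<forall>\<^sub>F x in F. adjoin_deriv y e P P' x = 0"
      using sep by eventually_elim (simp add: adjoin_deriv_def e_def)
    have "\<forall>\<^sub>F x in F. adjoin_deriv y e Q Q' x = 0"
      if "(Q, Q') \<in> poly_graph S" "\<forall>\<^sub>F x in F. poly (Q x) (y x) = 0" "\<forall>\<^sub>F x in F. degree (Q x) = j" for Q Q' j
      using that
    proof (induction j arbitrary: Q Q' rule: less_induct)
      case (less j)
      note Q = less.prems
      show ?case
      proof (cases "\<forall>\<^sub>F x in F. Q x = 0")
        case True
        then show ?thesis using poly_graph_eventually_zero[OF S Q(1)] by blast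
      next
        case False
        then have "m \<le> j" using H[OF Q(1,2) _ Q(3)] m_le by blast
        \<comment> \<open>One step of pseudo-division of Q by P. Multiplying Q by the leading
          coefficient of P replaces a division, since derivation graphs are closed under sums and
          products only.\<close>
        define a a' where "a = (\<lambda>x. coeff (P x) m)" and "a' = (\<lambda>x. coeff (P' x) m)"
        define b b' where "b = (\<lambda>x. - coeff (Q x) j)" and "b' = (\<lambda>x. - coeff (Q' x) j)"
        have a: "(\<lambda>x. [:a x:], \<lambda>x. [:a' x:]) \<in> poly_graph S"
          unfolding a_def a'_def by (rule poly_graph_const[OF S poly_graph_coeff[OF P]])
        have b: "(\<lambda>x. [:b x:], \<lambda>x. [:b' x:]) \<in> poly_graph S"
          using poly_graph_const[OF S derivation_graph_scale[OF S poly_graph_coeff[OF Q(1)], of "-1"]]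
          by (simp add: b_def b'_def)
        note X = poly_graph_X[OF S, of "j - m"]
        note XP = poly_graph_mult[OF S X P]
        note R = poly_graph_add[OF S poly_graph_mult[OF S a Q(1)] poly_graph_mult[OF S b XP]]
        define R R' where "R = (\<lambda>x. [:a x:] * Q x + [:b x:] * (monom 1 (j - m) * P x))"
          and "R' = (\<lambda>x. ([:a x:] * Q' x + [:a' x:] * Q x) +
            ([:b x:] * (monom 1 (j - m) * P' x + 0 * P x) + [:b' x:] * (monom 1 (j - m) * P x)))"
        have RR: "(R, R') \<in> poly_graph S" using R unfolding R_def R'_def .
        have R0: "\<forall>\<^sub>F x in F. poly (R x) (y x) = 0"
          using P0 Q(2) by eventually_elim (simp add: R_def)
        have Rdeg: "\<forall>\<^sub>F x in F. degree (R x) < j"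
          using Pm Q(3)
        proof eventually_elim
          case (elim x)
          have "degree (smult (b x) (monom 1 (j - m) * P x)) \<le> j"
          proof -
            have "degree (monom 1 (j - m) * P x) \<le> (j - m) + m"
              by (rule order_trans[OF degree_mult_le]) (use elim in \<open>simp add: degree_monom_eq\<close>)
            then show ?thesis using \<open>m \<le> j\<close> degree_smult_le[of "b x" "monom 1 (j - m) * P x"] by simp
          qed
          moreover have "degree (smult (a x) (Q x)) \<le> j"
            using elim degree_smult_le[of "a x" "Q x"] by simp
          ultimately have "degree (R x) \<le> j" by (simp add: R_def degree_add_le)
          moreover have "coeff (R x) j = 0"
            using \<open>m \<le> j\<close> by (simp add: R_def a_def b_def coeff_monom_mult)
          ultimately show ?case
            using \<open>m \<le> j\<close> \<open>m \<noteq> 0\<close> by (metis le_neq_implies_less degree_0 leading_coeff_0_iff le_zero_eq)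
        qed
        obtain j' where j': "\<forall>\<^sub>F x in F. degree (R x) = j'" using poly_graph_degree[OF F RR] .
        have "\<forall>\<^sub>F x in F. j' < j" using Rdeg j' by eventually_elim simp
        then have "j' < j" using F by (cases "j' < j") (auto simp: ultra_def)
        from less.IH[OF this RR R0 j'] have "\<forall>\<^sub>F x in F. adjoin_deriv y e R R' x = 0" .
        moreover have "adjoin_deriv y e R R' x =
            a x * adjoin_deriv y e Q Q' x + a' x * poly (Q x) (y x) +
            (b x * (y x ^ (j - m) * adjoin_deriv y e P P' x +
              adjoin_deriv y e (\<lambda>x. monom 1 (j - m)) (\<lambda>x. 0) x * poly (P x) (y x)) +
             b' x * (y x ^ (j - m) * poly (P x) (y x)))" for x
          unfolding R_def R'_def adjoin_deriv_add adjoin_deriv_mult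
          by (simp add: adjoin_deriv_def pderiv_mult pderiv_smult pderiv_pCons poly_monom algebra_simps)
        ultimately have "\<forall>\<^sub>F x in F. a x * adjoin_deriv y e Q Q' x + a' x * poly (Q x) (y x) +
            (b x * (y x ^ (j - m) * adjoin_deriv y e P P' x +
              adjoin_deriv y e (\<lambda>x. monom 1 (j - m)) (\<lambda>x. 0) x * poly (P x) (y x)) +
             b' x * (y x ^ (j - m) * poly (P x) (y x))) = 0" by simp
        \<comment> \<open>All terms but the first vanish along F, and \<open>a x\<close> is the
          leading coefficient of P.\<close>
        from this Pm P0 Q(2) DP show ?thesis
        proof eventually_elim
          case (elim x)
          then have "a x \<noteq> 0" by (auto simp: a_def)
          with elim show ?case by simp
        qed
      qed
    qed
    then show ?thesis using poly_graph_degree[OF F] by (intro exI[of _ e]) blast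
  qed
qed

text \<open>The extension consists of the values Q(y). Its null clause, that the derivative depends
  only on the value, is \<open>adjoin_deriv_well_defined\<close>; nothing is asked of y, so an
  arbitrary choice function can be adjoined.\<close>

theorem derivation_graph_adjoin:
  assumes F: "ultra F" and S: "derivation_graph F S"
  obtains e S' where "derivation_graph F S'" "S \<subseteq> S'" "(y, e) \<in> S'"
proof -
  obtain e where e: "\<And>Q Q'. (Q, Q') \<in> poly_graph S \<Longrightarrow> (\<forall>\<^sub>F x in F. poly (Q x) (y x) = 0) \<Longrightarrow>
      (\<forall>\<^sub>F x in F. adjoin_deriv y e Q Q' x = 0)"
    using adjoin_deriv_well_defined[OF F S, of y] by auto
  define S' where "S' = {(\<lambda>x. poly (Q x) (y x), adjoin_deriv y e Q Q') | Q Q'. (Q, Q') \<in> poly_graph S}"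
  have mem: "(f, f') \<in> S'" if "(Q, Q') \<in> poly_graph S" "\<And>x. f x = poly (Q x) (y x)"
      "\<And>x. f' x = adjoin_deriv y e Q Q' x" for f f' Q Q'
  proof -
    have "f = (\<lambda>x. poly (Q x) (y x))" "f' = adjoin_deriv y e Q Q'" using that(2,3) by auto
    then show ?thesis using that(1) unfolding S'_def by blast
  qed
  have sub: "S \<subseteq> S'"
  proof clarify
    fix a a' assume "(a, a') \<in> S"
    from poly_graph_const[OF S this] show "(a, a') \<in> S'"
      by (rule mem) (auto simp: adjoin_deriv_def pderiv_pCons)
  qed
  moreover have "(y, e) \<in> S'"
    by (rule mem[OF poly_graph_X[OF S, of 1]]) (auto simp: adjoin_deriv_def poly_monom pderiv_monom)
  moreover have "derivation_graph F S'"
    unfolding derivation_graph_def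
  proof (intro conjI allI impI)
    show "(\<lambda>_. c, \<lambda>_. 0) \<in> S'" for c using sub derivation_graph_const[OF S] by blast
  next
    fix a a' b b' assume "(a, a') \<in> S'" "(b, b') \<in> S'"
    then obtain Q Q' R R' where *: "(Q, Q') \<in> poly_graph S" "(R, R') \<in> poly_graph S"
      "a = (\<lambda>x. poly (Q x) (y x))" "a' = adjoin_deriv y e Q Q'"
      "b = (\<lambda>x. poly (R x) (y x))" "b' = adjoin_deriv y e R R'"
      unfolding S'_def by blast
    show "(\<lambda>x. a x + b x, \<lambda>x. a' x + b' x) \<in> S'"
      by (rule mem[OF poly_graph_add[OF S *(1,2)]]) (simp_all add: * adjoin_deriv_add)
    show "(\<lambda>x. a x * b x, \<lambda>x. a x * b' x + a' x * b x) \<in> S'"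
      by (rule mem[OF poly_graph_mult[OF S *(1,2)]]) (simp_all add: * adjoin_deriv_mult)
  next
    fix a a' assume "(a, a') \<in> S'" "\<forall>\<^sub>F x in F. a x = 0"
    then show "\<forall>\<^sub>F x in F. a' x = 0" using e unfolding S'_def by auto
  qed
  ultimately show ?thesis using that by blast
qed

section \<open>Generic translates of a plane\<close>

text \<open>On the line through the two witnesses both functions become nonzero polynomials in one
  variable, each with finitely many zeros.\<close>

lemma real_polynomial_function_mult_nonzero:
  fixes f g :: "'a::real_normed_vector \<Rightarrow> real"
  assumes f: "real_polynomial_function f" "f a \<noteq> 0" and g: "real_polynomial_function g" "g b \<noteq> 0"
  shows "\<exists>z. f z * g z \<noteq> 0"
proof -
  define l where "l t = a + t *\<^sub>R (b - a)" for t :: real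
  have l: "polynomial_function l"
    unfolding l_def by (intro polynomial_function_add polynomial_function_const polynomial_function_mult
        polynomial_function_id)
  have fin: "finite {t. h (l t) = 0}" if "real_polynomial_function h" "h (l s) \<noteq> 0" for h s
  proof -
    have "real_polynomial_function (h \<circ> l)" by (rule real_polynomial_function_compose[OF l that(1)])
    then obtain c n where c: "h \<circ> l = (\<lambda>x. \<Sum>i\<le>n. c i * x ^ i)"
      by (auto simp: real_polynomial_function_iff_sum)
    have "\<exists>i\<le>n. c i \<noteq> 0"
    proof (rule ccontr)
      assume "\<not> ?thesis"
      then have "(h \<circ> l) s = 0" unfolding c by simp
      with that(2) show False by simp
    qed
    then have "finite {x. (\<Sum>i\<le>n. c i * x ^ i) = 0}" by (auto simp: polyfun_finite_roots)
    moreover have "h (l t) = (\<Sum>i\<le>n. c i * t ^ i)" for t using fun_cong[OF c, of t] by simp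
    ultimately show ?thesis by simp
  qed
  have "finite ({t. f (l t) = 0} \<union> {t. g (l t) = 0})"
    using fin[OF f(1), of 0] fin[OF g(1), of 1] f(2) g(2) by (simp add: l_def)
  then have "{t. f (l t) = 0} \<union> {t. g (l t) = 0} \<noteq> UNIV"
    using infinite_UNIV_char_0 by metis
  then show ?thesis by auto
qed

text \<open>The hypothesis says that D is Zariski dense. The complements in D of hypersurfaces are
  then nonempty, and they form a filter base because a product of nonzero polynomials is nonzero;
  any ultrafilter containing them works.\<close>

lemma ultrafilter_generic:
  fixes D :: "'a::real_normed_vector set"
  assumes "\<And>h. real_polynomial_function h \<Longrightarrow> (\<And>z. z \<in> D \<Longrightarrow> h z = 0) \<Longrightarrow> h = (\<lambda>_. 0)"
  obtains F where "ultra F" "\<forall>\<^sub>F z in F. z \<in> D"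
    "\<And>h. real_polynomial_function h \<Longrightarrow> \<forall>\<^sub>F z in F. h z = 0 \<Longrightarrow> h = (\<lambda>_. 0)"
proof -
  let ?H = "{h :: 'a \<Rightarrow> real. real_polynomial_function h \<and> h \<noteq> (\<lambda>_. 0)}"
  let ?P = "\<lambda>h. principal {z \<in> D. h z \<noteq> (0::real)}"
  define F0 where "F0 = (INF h\<in>?H. ?P h)"
  have one: "(\<lambda>_. 1) \<in> ?H" by (auto simp: fun_eq_iff real_polynomial_function.intros(2))
  have ev: "eventually P F0 \<longleftrightarrow> (\<exists>h\<in>?H. eventually P (?P h))" for P
    unfolding F0_def
  proof (rule eventually_INF_base)
    show "?H \<noteq> {}" using one by blast
  next
    fix f g assume fg: "f \<in> ?H" "g \<in> ?H"
    then obtain a b where "f a \<noteq> 0" "g b \<noteq> 0" by (auto simp: fun_eq_iff)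
    then have "\<exists>z. f z * g z \<noteq> 0" using real_polynomial_function_mult_nonzero fg by blast
    then have "(\<lambda>z. f z * g z) \<in> ?H" using fg by (auto simp: fun_eq_iff)
    then show "\<exists>x\<in>?H. ?P x \<le> inf (?P f) (?P g)" by (rule bexI[rotated]) auto
  qed
  have "F0 \<noteq> bot"
    unfolding trivial_limit_def ev eventually_principal using assms by auto
  then obtain F where F: "F \<le> F0" "ultra F" using ultra_exists by blast
  have le: "eventually P F" if "h \<in> ?H" "eventually P (?P h)" for P h
    using F(1) ev that by (auto simp: le_filter_def)
  show ?thesis
  proof
    show "ultra F" by fact
    show "\<forall>\<^sub>F z in F. z \<in> D" by (rule le[OF one]) (simp add: eventually_principal)
  next
    fix h :: "'a \<Rightarrow> real" assume h: "real_polynomial_function h" "\<forall>\<^sub>F z in F. h z = 0"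
    show "h = (\<lambda>_. 0)"
    proof (rule ccontr)
      assume "h \<noteq> (\<lambda>_. 0)"
      then have "\<forall>\<^sub>F z in F. h z \<noteq> 0" by (intro le[of h]) (use h in \<open>auto simp: eventually_principal\<close>)
      with h(2) ultra_not[OF F(2), of "\<lambda>z. h z = 0"] show False by blast
    qed
  qed
qed

text \<open>The base of the extensions: complex-valued polynomials in the real vector z. Real and
  imaginary parts appear separately because genericity concerns real polynomials.\<close>

definition partial_graph :: "'n::finite \<Rightarrow> ((real^'n \<Rightarrow> complex) \<times> (real^'n \<Rightarrow> complex)) set" where
  "partial_graph i = {(f, f'). real_polynomial_function (\<lambda>z. Re (f z)) \<and>
     real_polynomial_function (\<lambda>z. Im (f z)) \<and>
     (\<forall>z. ((\<lambda>t. f (z + t *\<^sub>R axis i 1)) has_vector_derivative f' z) (at 0))}"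

text \<open>Genericity enters in the null clause: a polynomial vanishing along F vanishes
  identically, hence so does its derivative.\<close>

lemma derivation_graph_partial:
  fixes i :: "'n::finite"
  assumes gen: "\<And>h. real_polynomial_function h \<Longrightarrow> \<forall>\<^sub>F z in F. h z = 0 \<Longrightarrow> h = (\<lambda>_. 0)"
  shows "derivation_graph F (partial_graph i)"
  unfolding derivation_graph_def
proof (intro conjI allI impI)
  show "(\<lambda>_. c, \<lambda>_. 0) \<in> partial_graph i" for c
    by (auto simp: partial_graph_def)
next
  fix a a' b b' assume ab: "(a, a') \<in> partial_graph i" "(b, b') \<in> partial_graph i"
  then show "(\<lambda>x. a x + b x, \<lambda>x. a' x + b' x) \<in> partial_graph i"
    by (auto simp: partial_graph_def intro!: has_vector_derivative_add)
  have "((\<lambda>t. a (z + t *\<^sub>R axis i 1) * b (z + t *\<^sub>R axis i 1)) has_vector_derivative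
      a z * b' z + a' z * b z) (at 0)" for z
    using has_vector_derivative_mult[of "\<lambda>t. a (z + t *\<^sub>R axis i 1)" "a' z" 0 UNIV
        "\<lambda>t. b (z + t *\<^sub>R axis i 1)" "b' z"] ab by (auto simp: partial_graph_def)
  then show "(\<lambda>x. a x * b x, \<lambda>x. a x * b' x + a' x * b x) \<in> partial_graph i"
    using ab by (auto simp: partial_graph_def)
next
  fix a a' assume a: "(a, a') \<in> partial_graph i" "\<forall>\<^sub>F z in F. a z = 0"
  have "(\<lambda>z. Re (a z)) = (\<lambda>_. 0)" "(\<lambda>z. Im (a z)) = (\<lambda>_. 0)"
    by (rule gen; use a in \<open>auto simp: partial_graph_def elim: eventually_mono\<close>)+
  then have "a z = 0" for z by (simp add: complex_eq_iff fun_eq_iff)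
  then have "((\<lambda>t. 0) has_vector_derivative a' z) (at (0::real))" for z
    using a(1) by (auto simp: partial_graph_def)
  then have "a' z = 0" for z
    using vector_derivative_unique_at has_vector_derivative_const by metis
  then show "\<forall>\<^sub>F z in F. a' z = 0" by simp
qed

lemma partial_graph_nth:
  fixes i k :: "'n::finite"
  shows   "(\<lambda>z. complex_of_real (z $ k), \<lambda>_. if k = i then 1 else 0) \<in> partial_graph i"
proof -
  have "((\<lambda>t. complex_of_real ((z + t *\<^sub>R axis i 1) $ k)) has_vector_derivative (if k = i then 1 else 0)) (at 0)" for z
    by (auto simp: axis_def intro!: derivative_eq_intros)
  moreover have "real_polynomial_function (\<lambda>z :: real^'n. z $ k)" for k
    by (rule real_polynomial_function.intros(1)) (rule bounded_linear_vec_nth)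
  moreover have "real_polynomial_function (\<lambda>z :: real^'n. 0)" by (rule real_polynomial_function.intros(2))
  ultimately show ?thesis
    by (simp add: partial_graph_def)
qed

text \<open>A form of Bertini's theorem. If it failed, the tangency point would be a function of the
  translation vector \<open>z\<close>; differentiating \<open>B = 0\<close> with respect to \<open>z\<^sub>i\<close> at that point shows that
  \<open>\<partial>\<^sub>iB\<close> vanishes there, because \<open>\<partial>B\<close> annihilates \<open>V\<close> and \<open>V'\<close>.\<close>

theorem generic_translate_transversal:
  fixes B :: "('n::finite \<Rightarrow> complex) \<Rightarrow> complex" and dB :: "'n \<Rightarrow> ('n \<Rightarrow> complex) \<Rightarrow> complex"
    and V V' :: "'n \<Rightarrow> complex"
  defines "X \<equiv> \<lambda>(z::real^'n) y1 y2 k. V k * y1 + V' k * y2 + of_real (z $ k)"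
  assumes grad: "\<And>F S (a :: 'n \<Rightarrow> real^'n \<Rightarrow> complex) a'. derivation_graph F S \<Longrightarrow> (\<And>k. (a k, a' k) \<in> S) \<Longrightarrow>
      (\<lambda>z. B (\<lambda>k. a k z), \<lambda>z. \<Sum>k\<in>UNIV. dB k (\<lambda>k. a k z) * a' k z) \<in> S"
    and C: "finite C" "\<And>c. c \<in> C \<Longrightarrow> real_polynomial_function c \<and> c \<noteq> (\<lambda>_. 0)"
    and sing: "\<And>z y1 y2. B (X z y1 y2) = 0 \<Longrightarrow> (\<And>k. dB k (X z y1 y2) = 0) \<Longrightarrow> \<exists>c\<in>C. c z = 0"
  obtains h where "real_polynomial_function h" "h \<noteq> (\<lambda>_. 0)"
    "\<And>z y1 y2. B (X z y1 y2) = 0 \<Longrightarrow> (\<Sum>k\<in>UNIV. dB k (X z y1 y2) * V k) = 0 \<Longrightarrow>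
       (\<Sum>k\<in>UNIV. dB k (X z y1 y2) * V' k) = 0 \<Longrightarrow> h z = 0"
proof -
  define bad where "bad z y1 y2 \<longleftrightarrow> B (X z y1 y2) = 0 \<and> (\<Sum>k\<in>UNIV. dB k (X z y1 y2) * V k) = 0 \<and>
       (\<Sum>k\<in>UNIV. dB k (X z y1 y2) * V' k) = 0" for z y1 y2
  define D where "D = {z. \<exists>y1 y2. bad z y1 y2}"
  have "\<exists>h. real_polynomial_function h \<and> (\<forall>z\<in>D. h z = 0) \<and> h \<noteq> (\<lambda>_. 0)"
  proof (rule ccontr)
    assume "\<not> ?thesis"
    then have "h = (\<lambda>_. 0)" if "real_polynomial_function h" "\<And>z. z \<in> D \<Longrightarrow> h z = 0" for h
      using that by blast
    then obtain F where F: "ultra F" "\<forall>\<^sub>F z in F. z \<in> D"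
      and gen: "\<And>h. real_polynomial_function h \<Longrightarrow> \<forall>\<^sub>F z in F. h z = 0 \<Longrightarrow> h = (\<lambda>_. 0)"
      by (rule ultrafilter_generic) blast+
    have "\<forall>z\<in>D. \<exists>y. bad z (fst y) (snd y)" by (auto simp: D_def)
    then obtain y where y: "\<And>z. z \<in> D \<Longrightarrow> bad z (fst (y z)) (snd (y z))" by metis
    define y1 y2 where "y1 z = fst (y z)" and "y2 z = snd (y z)" for z
    have "bad z (y1 z) (y2 z)" if "z \<in> D" for z using y[OF that] by (simp add: y1_def y2_def)
    then have bad: "\<forall>\<^sub>F z in F. bad z (y1 z) (y2 z)" using F(2) by (auto elim: eventually_mono)
    have "\<forall>\<^sub>F z in F. dB i (X z (y1 z) (y2 z)) = 0" for i
    proof -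
      \<comment> \<open>The two coordinates of the point are adjoined one after the other. The
        extension depends on i, but the conclusion about \<open>dB i\<close> does not mention
        it.\<close>
      obtain e1 S1 where S1: "derivation_graph F S1" "partial_graph i \<subseteq> S1" "(y1, e1) \<in> S1"
        by (rule derivation_graph_adjoin[OF F(1) derivation_graph_partial[OF gen]])
      obtain e2 S2 where S2: "derivation_graph F S2" "S1 \<subseteq> S2" "(y2, e2) \<in> S2"
        by (rule derivation_graph_adjoin[OF F(1) S1(1)])
      have "(\<lambda>z. X z (y1 z) (y2 z) k, \<lambda>z. V k * e1 z + V' k * e2 z + (if k = i then 1 else 0)) \<in> S2" for k
        unfolding X_def using partial_graph_nth[of k i] S1 S2
        by (intro derivation_graph_add[OF S2(1)] derivation_graph_scale[OF S2(1)]) auto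
      from grad[OF S2(1) this] have
        "(\<lambda>z. B (X z (y1 z) (y2 z)), \<lambda>z. \<Sum>k\<in>UNIV. dB k (X z (y1 z) (y2 z)) *
            (V k * e1 z + V' k * e2 z + (if k = i then 1 else 0))) \<in> S2" .
      moreover have "\<forall>\<^sub>F z in F. B (X z (y1 z) (y2 z)) = 0"
        using bad by (auto simp: bad_def elim: eventually_mono)
      ultimately have
        "\<forall>\<^sub>F z in F. (\<Sum>k\<in>UNIV. dB k (X z (y1 z) (y2 z)) *
            (V k * e1 z + V' k * e2 z + (if k = i then 1 else 0))) = 0"
        by (rule derivation_graph_null[OF S2(1)])
      moreover have "(\<Sum>k\<in>UNIV. dB k x * (V k * e1 z + V' k * e2 z + (if k = i then 1 else 0))) =
          (\<Sum>k\<in>UNIV. dB k x * V k) * e1 z + (\<Sum>k\<in>UNIV. dB k x * V' k) * e2 z + dB i x" for x z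
      proof -
        have "(\<Sum>k\<in>UNIV. dB k x * (V k * e1 z + V' k * e2 z + (if k = i then 1 else 0))) =
          (\<Sum>k\<in>UNIV. dB k x * V k * e1 z + dB k x * V' k * e2 z + (if k = i then dB k x else 0))"
          by (intro sum.cong) (auto simp: algebra_simps)
        then show ?thesis by (simp add: sum.distrib sum_distrib_right)
      qed
      ultimately have "\<forall>\<^sub>F z in F. (\<Sum>k\<in>UNIV. dB k (X z (y1 z) (y2 z)) * V k) * e1 z +
          (\<Sum>k\<in>UNIV. dB k (X z (y1 z) (y2 z)) * V' k) * e2 z + dB i (X z (y1 z) (y2 z)) = 0" by simp
      with bad show ?thesis by eventually_elim (simp add: bad_def)
    qed
    then have "\<forall>\<^sub>F z in F. \<forall>i\<in>UNIV. dB i (X z (y1 z) (y2 z)) = 0"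
      by (intro eventually_ball_finite) auto
    \<comment> \<open>The form c supplied by \<open>sing\<close> varies with z; primality fixes one
      c that vanishes along F, which genericity forbids.\<close>
    with bad have "\<forall>\<^sub>F z in F. \<exists>c\<in>C. c z = 0"
      by eventually_elim (auto simp: bad_def intro!: sing)
    then obtain c where "c \<in> C" "\<forall>\<^sub>F z in F. c z = 0"
      using ultra_finite_disj[OF F(1) C(1), of "\<lambda>c z. c z = 0"] by blast
    with gen C(2) show False by blast
  qed
  then obtain h where h: "real_polynomial_function h" "\<forall>z\<in>D. h z = 0" "h \<noteq> (\<lambda>_. 0)" by blast
  show ?thesis
  proof (rule that[OF h(1,3)])
    fix z y1 y2
    assume "B (X z y1 y2) = 0" "(\<Sum>k\<in>UNIV. dB k (X z y1 y2) * V k) = 0"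
       "(\<Sum>k\<in>UNIV. dB k (X z y1 y2) * V' k) = 0"
    then have "z \<in> D" unfolding D_def bad_def by blast
    with h(2) show "h z = 0" by blast
  qed
qed

section \<open>The singular locus of the cyclic polynomial\<close>

definition cyc_poly :: "('n::finite \<Rightarrow> 'n) \<Rightarrow> ('n \<Rightarrow> 'a::comm_ring_1) \<Rightarrow> ('n \<Rightarrow> 'a) \<Rightarrow> 'a" where
  "cyc_poly \<sigma> c x = (\<Sum>i\<in>UNIV. c i * (\<Prod>j\<in>UNIV - {i, \<sigma> i}. x j))"

text \<open>The formal partial derivative of \<open>cyc_poly\<close> in coordinate k: terms with k
  \<in> {i, \<sigma> i} do not contain x_k and disappear.\<close>

definition dcyc_poly :: "('n::finite \<Rightarrow> 'n) \<Rightarrow> ('n \<Rightarrow> 'a::comm_ring_1) \<Rightarrow> 'n \<Rightarrow> ('n \<Rightarrow> 'a) \<Rightarrow> 'a" where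
  "dcyc_poly \<sigma> c k x = (\<Sum>i | k \<notin> {i, \<sigma> i}. c i * (\<Prod>j\<in>UNIV - {i, \<sigma> i, k}. x j))"

text \<open>Interchanging the sums turns the product rule, collected by monomials, into a gradient,
  collected by coordinates. With x' arbitrary it serves derivation graphs and polynomial rings
  alike.\<close>

lemma dcyc_poly_gradient:
  "(\<Sum>i\<in>UNIV. c i * (\<Sum>k\<in>UNIV - {i, \<sigma> i}. (\<Prod>j\<in>UNIV - {i, \<sigma> i} - {k}. x j) * x' k)) =
    (\<Sum>k\<in>UNIV. dcyc_poly \<sigma> c k x * x' k)"
proof -
  have "(\<Sum>i\<in>UNIV. c i * (\<Sum>k\<in>UNIV - {i, \<sigma> i}. (\<Prod>j\<in>UNIV - {i, \<sigma> i} - {k}. x j) * x' k)) =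
    (\<Sum>i\<in>UNIV. \<Sum>k | k \<in> UNIV \<and> k \<notin> {i, \<sigma> i}. c i * (\<Prod>j\<in>UNIV - {i, \<sigma> i, k}. x j) * x' k)"
  proof -
    have "UNIV - {i, \<sigma> i, k} = UNIV - {i, \<sigma> i} - {k}" for i k by auto
    then show ?thesis unfolding sum_distrib_left
      by (intro sum.cong refl) (auto simp: mult.assoc)
  qed
  also have "\<dots> = (\<Sum>k\<in>UNIV. \<Sum>i | i \<in> UNIV \<and> k \<notin> {i, \<sigma> i}. c i * (\<Prod>j\<in>UNIV - {i, \<sigma> i, k}. x j) * x' k)"
    by (rule sum.swap_restrict) auto
  also have "\<dots> = (\<Sum>k\<in>UNIV. dcyc_poly \<sigma> c k x * x' k)"
    by (simp add: dcyc_poly_def sum_distrib_right)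
  finally show ?thesis .
qed

lemma derivation_graph_cyc_poly:
  assumes "derivation_graph F S" "\<And>k. (a k, a' k) \<in> S"
  shows "(\<lambda>z. cyc_poly \<sigma> c (\<lambda>k. a k z), \<lambda>z. \<Sum>k\<in>UNIV. dcyc_poly \<sigma> c k (\<lambda>k. a k z) * a' k z) \<in> S"
  unfolding dcyc_poly_gradient[symmetric] cyc_poly_def
  by (intro derivation_graph_sum[OF assms(1)] derivation_graph_scale[OF assms(1)]
      derivation_graph_prod[OF assms(1)] assms(2)) auto

section \<open>Linear forms that are constant along a plane\<close>

lemma linear_dependency_plane:
  fixes a b c :: "real \<times> real"
  obtains \<alpha> \<beta> \<gamma> where "\<alpha> *\<^sub>R a + \<beta> *\<^sub>R b + \<gamma> *\<^sub>R c = 0" "\<alpha> \<noteq> 0 \<or> \<beta> \<noteq> 0 \<or> \<gamma> \<noteq> 0"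
proof -
  obtain a1 a2 b1 b2 c1 c2 where *: "a = (a1, a2)" "b = (b1, b2)" "c = (c1, c2)"
    by (cases a, cases b, cases c) auto
  let ?d = "\<lambda>x y z w. x * w - y * z :: real"
  consider "?d a1 a2 b1 b2 \<noteq> 0" | "?d a1 a2 b1 b2 = 0" "a1 \<noteq> 0" | "?d a1 a2 b1 b2 = 0" "a2 \<noteq> 0"
    | "a = 0" using *(1) by (auto simp: zero_prod_def)
  then show ?thesis
  proof cases
    \<comment> \<open>Cramer's rule: each vector is weighted by the determinant of the other two, in
      cyclic order.\<close>
    case 1
    then show ?thesis
      by (intro that[of "?d b1 b2 c1 c2" "?d c1 c2 a1 a2" "?d a1 a2 b1 b2"])
        (auto simp: * zero_prod_def algebra_simps)
  next
    case 2
    then show ?thesis by (intro that[of b1 "- a1" 0]) (auto simp: * zero_prod_def algebra_simps)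
  next
    case 3
    then show ?thesis by (intro that[of b2 "- a2" 0]) (auto simp: * zero_prod_def algebra_simps)
  next
    case 4
    then show ?thesis by (intro that[of 1 0 0]) auto
  qed
qed

text \<open>The forms \<open>x\<^sub>k\<close>, \<open>x\<^sub>l\<close>, \<open>f\<close> are independent, so some combination of them vanishes on a
  given plane and hence is invariant under translations along it.\<close>

lemma hyperplane_through_plane:
  fixes V V' :: "'n::finite \<Rightarrow> real" and f :: "real^'n"
  assumes "k \<noteq> l" "f $ k = 0" "f $ l = 0" "f \<noteq> 0"
  obtains c :: "real^'n" where "c \<noteq> 0" "(\<Sum>j\<in>UNIV. c $ j * V j) = 0" "(\<Sum>j\<in>UNIV. c $ j * V' j) = 0"
    "\<And>x :: 'n \<Rightarrow> complex. x k = 0 \<Longrightarrow> x l = 0 \<Longrightarrow> (\<Sum>j\<in>UNIV. of_real (f $ j) * x j) = 0 \<Longrightarrow>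
      (\<Sum>j\<in>UNIV. of_real (c $ j) * x j) = 0"
proof -
  let ?s = "\<lambda>V. \<Sum>j\<in>UNIV. f $ j * V j"
  obtain \<alpha> \<beta> \<gamma> where dep: "\<alpha> *\<^sub>R (V k, V' k) + \<beta> *\<^sub>R (V l, V' l) + \<gamma> *\<^sub>R (?s V, ?s V') = 0"
    and nz: "\<alpha> \<noteq> 0 \<or> \<beta> \<noteq> 0 \<or> \<gamma> \<noteq> 0" by (rule linear_dependency_plane)
  define c where "c = \<alpha> *\<^sub>R axis k 1 + \<beta> *\<^sub>R axis l 1 + \<gamma> *\<^sub>R f"
  have sum: "(\<Sum>j\<in>UNIV. of_real (c $ j) * x j) =
      of_real \<alpha> * x k + of_real \<beta> * x l + of_real \<gamma> * (\<Sum>j\<in>UNIV. of_real (f $ j) * x j)"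
    for x :: "'n \<Rightarrow> 'b::real_normed_field"
  proof -
    have "(\<Sum>j\<in>UNIV. of_real (c $ j) * x j) = (\<Sum>j\<in>UNIV. (if j = k then of_real \<alpha> * x j else 0) +
      (if j = l then of_real \<beta> * x j else 0) + of_real \<gamma> * (of_real (f $ j) * x j))"
      by (intro sum.cong) (auto simp: c_def axis_def algebra_simps)
    then show ?thesis by (simp add: sum.distrib sum_distrib_left)
  qed
  show ?thesis
  proof
    \<comment> \<open>A coordinate where f is nonzero differs from k and l, so it detects \<gamma>,
      while the coordinates k and l detect \<alpha> and \<beta>.\<close>
    obtain j where "f $ j \<noteq> 0" using assms(4) by (auto simp: vec_eq_iff)
    then have "c $ j = \<gamma> * f $ j" using assms by (auto simp: c_def axis_def)
    moreover have "c $ k = \<alpha>" "c $ l = \<beta>" using assms by (auto simp: c_def axis_def)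
    ultimately show "c \<noteq> 0" using nz \<open>f $ j \<noteq> 0\<close> by auto
    show "(\<Sum>j\<in>UNIV. c $ j * V j) = 0" using sum[of V] dep by (simp add: zero_prod_def)
    show "(\<Sum>j\<in>UNIV. c $ j * V' j) = 0" using sum[of V'] dep by (simp add: zero_prod_def)
  next
    fix x :: "'n \<Rightarrow> complex"
    assume "x k = 0" "x l = 0" "(\<Sum>j\<in>UNIV. of_real (f $ j) * x j) = 0"
    then show "(\<Sum>j\<in>UNIV. of_real (c $ j) * x j) = 0" by (simp add: sum)
  qed
qed

text \<open>By \<open>ne1\<close> and \<open>ne2\<close> the indices i, \<sigma> i, \<sigma>
  (\<sigma> i) are distinct: each monomial of B omits exactly two coordinates, and different terms
  omit different pairs.\<close>

locale weighted_cycle =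
  fixes \<sigma> :: "'n::finite \<Rightarrow> 'n" and m :: "'n \<Rightarrow> real"
  assumes bij: "bij \<sigma>" and ne1: "\<sigma> i \<noteq> i" and ne2: "\<sigma> (\<sigma> i) \<noteq> i" and pos: "m i > 0"
begin

lemma succ_eq_iff: "\<sigma> i = \<sigma> j \<longleftrightarrow> i = j"
  using bij by (auto simp: bij_def inj_eq)

lemma succ_surjE: obtains t where "\<sigma> t = k"
  using bij by (metis bij_pointE)

abbreviation B :: "('n \<Rightarrow> complex) \<Rightarrow> complex" where "B \<equiv> cyc_poly \<sigma> (\<lambda>i. of_real (m i))"
abbreviation dB :: "'n \<Rightarrow> ('n \<Rightarrow> complex) \<Rightarrow> complex" where "dB \<equiv> dcyc_poly \<sigma> (\<lambda>i. of_real (m i))"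

text \<open>With P the product of all coordinates, B is P times the sum of all \<open>q i\<close>,
  and the derivative in coordinate k is P w_k times the sum over the terms not involving w_k. For k
  = \<sigma> i the difference of the two sums is q_i + q_(\<sigma> i), which is w_k times the k-th
  partial derivative of the quadratic form in w.\<close>

lemma singular_torus:
  assumes nz: "\<And>k. x k \<noteq> 0" and B: "B x = 0" and dB: "\<And>k. dB k x = 0"
  obtains w :: "'n \<Rightarrow> complex" where "\<And>k. w k \<noteq> 0" "\<And>i. of_real (m (\<sigma> i)) * w (\<sigma> (\<sigma> i)) = - (of_real (m i) * w i)"
proof -
  define w where "w k = 1 / x k" for k
  define P where "P = (\<Prod>k\<in>UNIV. x k)"
  have "P \<noteq> 0" using nz by (simp add: P_def)
  have w: "w k \<noteq> 0" for k using nz by (simp add: w_def)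
  have prod2: "(\<Prod>j\<in>UNIV - {i, j}. x j) = P * (w i * w j)" if "i \<noteq> j" for i j
  proof -
    have "P = (\<Prod>j\<in>UNIV - {i, j}. x j) * (\<Prod>j\<in>{i, j}. x j)"
      unfolding P_def by (rule prod.subset_diff) auto
    then show ?thesis using that nz by (simp add: w_def)
  qed
  have prod3: "(\<Prod>j\<in>UNIV - {i, j, k}. x j) = P * w k * (w i * w j)" if "i \<noteq> j" "k \<noteq> i" "k \<noteq> j" for i j k
  proof -
    have "P = (\<Prod>j\<in>UNIV - {i, j, k}. x j) * (\<Prod>j\<in>{i, j, k}. x j)"
      unfolding P_def by (rule prod.subset_diff) auto
    then show ?thesis using that nz by (simp add: w_def)
  qed
  define q where "q i = of_real (m i) * (w i * w (\<sigma> i))" for i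
  have "B x = P * (\<Sum>i\<in>UNIV. q i)"
    by (simp add: cyc_poly_def prod2 ne1[symmetric] q_def sum_distrib_left mult_ac)
  with B \<open>P \<noteq> 0\<close> have q0: "(\<Sum>i\<in>UNIV. q i) = 0" by simp
  have "of_real (m (\<sigma> i)) * w (\<sigma> (\<sigma> i)) = - (of_real (m i) * w i)" for i
  proof -
    have set: "{j. \<sigma> i \<notin> {j, \<sigma> j}} = UNIV - {i, \<sigma> i}" using succ_eq_iff by auto
    have "dB (\<sigma> i) x = P * w (\<sigma> i) * (\<Sum>j\<in>UNIV - {i, \<sigma> i}. q j)"
      unfolding dcyc_poly_def set sum_distrib_left
    proof (intro sum.cong refl)
      fix j assume "j \<in> UNIV - {i, \<sigma> i}"
      then have "(\<Prod>j\<in>UNIV - {j, \<sigma> j, \<sigma> i}. x j) = P * w (\<sigma> i) * (w j * w (\<sigma> j))"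
        using prod3[of j "\<sigma> j" "\<sigma> i"] ne1[of j] succ_eq_iff by auto
      then show "complex_of_real (m j) * (\<Prod>j\<in>UNIV - {j, \<sigma> j, \<sigma> i}. x j) = P * w (\<sigma> i) * q j"
        by (simp add: q_def mult_ac)
    qed
    then have "(\<Sum>j\<in>UNIV - {i, \<sigma> i}. q j) = 0" using dB \<open>P \<noteq> 0\<close> w by simp
    moreover have "(\<Sum>j\<in>UNIV. q j) = (\<Sum>j\<in>UNIV - {i, \<sigma> i}. q j) + (\<Sum>j\<in>{i, \<sigma> i}. q j)"
      by (rule sum.subset_diff) auto
    ultimately have "q i + q (\<sigma> i) = 0" using q0 ne1[of i] by simp
    then have "w (\<sigma> i) * (of_real (m (\<sigma> i)) * w (\<sigma> (\<sigma> i)) + of_real (m i) * w i) = 0"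
      by (simp add: q_def algebra_simps)
    then show ?thesis using w[of "\<sigma> i"] by (simp add: eq_neg_iff_add_eq_0)
  qed
  from that[OF w this] show ?thesis .
qed

text \<open>Differentiate in the coordinate of the predecessor t of k. Only the terms t and k of B
  omit x_k; the term t does not contain x_t, and the term k leaves a product of nonzero
  coordinates.\<close>

lemma no_singular_point_with_one_zero:
  assumes x: "x k = 0" "\<And>j. j \<noteq> k \<Longrightarrow> x j \<noteq> 0" and dB: "\<And>k. dB k x = 0"
  shows False
proof -
  obtain t where t: "\<sigma> t = k" by (rule succ_surjE)
  have tk: "t \<noteq> k" "t \<noteq> \<sigma> k" using ne1[of t] ne2[of t] t by auto
  have "dB t x = (\<Sum>i\<in>{k}. of_real (m i) * (\<Prod>j\<in>UNIV - {i, \<sigma> i, t}. x j))"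
    unfolding dcyc_poly_def
  proof (rule sum.mono_neutral_right)
    show "{k} \<subseteq> {i. t \<notin> {i, \<sigma> i}}" using tk by auto
    show "\<forall>i\<in>{i. t \<notin> {i, \<sigma> i}} - {k}. complex_of_real (m i) * (\<Prod>j\<in>UNIV - {i, \<sigma> i, t}. x j) = 0"
    proof
      fix i assume "i \<in> {i. t \<notin> {i, \<sigma> i}} - {k}"
      then have "k \<in> UNIV - {i, \<sigma> i, t}" using tk t succ_eq_iff by auto
      then show "complex_of_real (m i) * (\<Prod>j\<in>UNIV - {i, \<sigma> i, t}. x j) = 0" using x(1) by auto
    qed
  qed auto
  also have "\<dots> \<noteq> 0" using x(2) pos[of k] by simp
  finally show False using dB by blast
qed

text \<open>The term k is the only one omitting both zero coordinates, and it is a product of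
  nonzero numbers.\<close>

lemma no_point_with_adjacent_zeros:
  assumes x: "x k = 0" "x (\<sigma> k) = 0" "\<And>j. j \<noteq> k \<Longrightarrow> j \<noteq> \<sigma> k \<Longrightarrow> x j \<noteq> 0" and B: "B x = 0"
  shows False
proof -
  have "B x = (\<Sum>i\<in>{k}. of_real (m i) * (\<Prod>j\<in>UNIV - {i, \<sigma> i}. x j))"
    unfolding cyc_poly_def
  proof (rule sum.mono_neutral_right)
    show "\<forall>i\<in>UNIV - {k}. complex_of_real (m i) * (\<Prod>j\<in>UNIV - {i, \<sigma> i}. x j) = 0"
    proof
      fix i assume "i \<in> UNIV - {k}"
      then have "k \<in> UNIV - {i, \<sigma> i} \<or> \<sigma> k \<in> UNIV - {i, \<sigma> i}" using succ_eq_iff ne2[of i] by auto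
      then show "complex_of_real (m i) * (\<Prod>j\<in>UNIV - {i, \<sigma> i}. x j) = 0" using x(1,2) by auto
    qed
  qed auto
  also have "\<dots> \<noteq> 0" using x(3) pos[of k] by simp
  finally show False using B by blast
qed

text \<open>The possible third equations of a singular point that already has two zero coordinates:
  either a third coordinate vanishes, or the two neighbours t and \<sigma> (\<sigma> t) of a zero
  coordinate \<sigma> t satisfy a relation with the adjacent weights.\<close>

definition third_forms :: "(real^'n) set" where
  "third_forms = range (\<lambda>j. axis j 1) \<union> range (\<lambda>t. m (\<sigma> t) *\<^sub>R axis t 1 + m t *\<^sub>R axis (\<sigma> (\<sigma> t)) 1)"

text \<open>In the derivative by x_k only the two terms omitting x_l survive, those of l and of its
  predecessor t. After cancelling their common nonzero factor a linear relation between x_t and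
  x_(\<sigma> l) remains.\<close>

lemma third_forms_nonadjacent:
  assumes x: "x k = 0" "x l = 0" "\<And>j. j \<noteq> k \<Longrightarrow> j \<noteq> l \<Longrightarrow> x j \<noteq> 0"
    and kl: "k \<noteq> l" "l \<noteq> \<sigma> k" "k \<noteq> \<sigma> l" and dB: "\<And>k. dB k x = 0"
  shows "\<exists>f\<in>third_forms. f $ k = 0 \<and> f $ l = 0 \<and> f \<noteq> 0 \<and> (\<Sum>j\<in>UNIV. of_real (f $ j) * x j) = 0"
proof -
  obtain t where t: "\<sigma> t = l" by (rule succ_surjE)
  have tl: "t \<noteq> l" "t \<noteq> \<sigma> l" "t \<noteq> k" "\<sigma> l \<noteq> l" using ne1[of t] ne2[of t] ne1[of l] kl t by auto
  have "dB k x = (\<Sum>i\<in>{l, t}. of_real (m i) * (\<Prod>j\<in>UNIV - {i, \<sigma> i, k}. x j))"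
    unfolding dcyc_poly_def
  proof (rule sum.mono_neutral_right)
    show "{l, t} \<subseteq> {i. k \<notin> {i, \<sigma> i}}" using tl kl t by auto
    show "\<forall>i\<in>{i. k \<notin> {i, \<sigma> i}} - {l, t}. complex_of_real (m i) * (\<Prod>j\<in>UNIV - {i, \<sigma> i, k}. x j) = 0"
    proof
      fix i assume "i \<in> {i. k \<notin> {i, \<sigma> i}} - {l, t}"
      then have "l \<in> UNIV - {i, \<sigma> i, k}" using tl kl t succ_eq_iff by auto
      then show "complex_of_real (m i) * (\<Prod>j\<in>UNIV - {i, \<sigma> i, k}. x j) = 0" using x(2) by auto
    qed
  qed auto
  also have "\<dots> = of_real (m l) * (\<Prod>j\<in>UNIV - {l, \<sigma> l, k}. x j) + of_real (m t) * (\<Prod>j\<in>UNIV - {t, l, k}. x j)"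
    using tl t by simp
  also have "(\<Prod>j\<in>UNIV - {l, \<sigma> l, k}. x j) = x t * (\<Prod>j\<in>UNIV - {l, \<sigma> l, k, t}. x j)"
  proof -
    have "UNIV - {l, \<sigma> l, k, t} = UNIV - {l, \<sigma> l, k} - {t}" by auto
    then show ?thesis using prod.remove[of "UNIV - {l, \<sigma> l, k}" t x] tl by simp
  qed
  also have "(\<Prod>j\<in>UNIV - {t, l, k}. x j) = x (\<sigma> l) * (\<Prod>j\<in>UNIV - {l, \<sigma> l, k, t}. x j)"
  proof -
    have "UNIV - {l, \<sigma> l, k, t} = UNIV - {t, l, k} - {\<sigma> l}" by auto
    then show ?thesis using prod.remove[of "UNIV - {t, l, k}" "\<sigma> l" x] tl kl by simp
  qed
  finally have "(of_real (m l) * x t + of_real (m t) * x (\<sigma> l)) * (\<Prod>j\<in>UNIV - {l, \<sigma> l, k, t}. x j) = 0"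
    using dB[of k] by (simp add: algebra_simps)
  moreover have "(\<Prod>j\<in>UNIV - {l, \<sigma> l, k, t}. x j) \<noteq> 0" using x(3) by auto
  ultimately have rel: "of_real (m l) * x t + of_real (m t) * x (\<sigma> l) = 0" by simp
  define f where "f = m (\<sigma> t) *\<^sub>R axis t (1::real) + m t *\<^sub>R axis (\<sigma> (\<sigma> t)) 1"
  have "f \<in> third_forms" by (auto simp: third_forms_def f_def)
  moreover have "f $ k = 0" "f $ l = 0" "f $ t = m l"
    using tl kl t by (auto simp: f_def axis_def)
  moreover have "f \<noteq> 0" using \<open>f $ t = m l\<close> pos[of l] by (metis less_irrefl zero_index)
  moreover have "(\<Sum>j\<in>UNIV. of_real (f $ j) * x j) = of_real (m l) * x t + of_real (m t) * x (\<sigma> l)"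
  proof -
    have "(\<Sum>j\<in>UNIV. of_real (f $ j) * x j) = (\<Sum>j\<in>{t, \<sigma> l}. of_real (f $ j) * x j)"
      by (rule sum.mono_neutral_right) (use tl t in \<open>auto simp: f_def axis_def\<close>)
    then show ?thesis using tl t by (simp add: f_def axis_def)
  qed
  ultimately show ?thesis using rel by auto
qed

text \<open>By the number of zero coordinates: a single one is impossible, a third one gives a
  coordinate form, and exactly two cannot be adjacent, which leaves the neighbour relation.\<close>

lemma singular_locus:
  assumes B: "B x = 0" and dB: "\<And>k. dB k x = 0" and zero: "x k0 = 0"
  shows "\<exists>k l. \<exists>f\<in>third_forms. k \<noteq> l \<and> x k = 0 \<and> x l = 0 \<and> f $ k = 0 \<and> f $ l = 0 \<and> f \<noteq> 0 \<and>
    (\<Sum>j\<in>UNIV. of_real (f $ j) * x j) = 0"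
proof -
  obtain l where l: "l \<noteq> k0" "x l = 0"
    using no_singular_point_with_one_zero[of x k0] zero dB by blast
  show ?thesis
  proof (cases "\<exists>j. x j = 0 \<and> j \<noteq> k0 \<and> j \<noteq> l")
    case True
    then obtain j where j: "x j = 0" "j \<noteq> k0" "j \<noteq> l" by blast
    have "(\<Sum>i\<in>UNIV. of_real (axis j 1 $ i) * x i) = (\<Sum>i\<in>{j}. of_real (axis j 1 $ i) * x i)"
      by (rule sum.mono_neutral_right) (auto simp: axis_def)
    then have "(\<Sum>i\<in>UNIV. of_real (axis j 1 $ i) * x i) = 0" using j by simp
    moreover have "axis j (1::real) $ k0 = 0" "axis j (1::real) $ l = 0" "axis j (1::real) \<noteq> 0"
      using j by (simp_all add: axis_def axis_nth vec_eq_iff)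
    moreover have "axis j 1 \<in> third_forms" by (auto simp: third_forms_def)
    ultimately show ?thesis using l zero by blast
  next
    case False
    then have other: "\<And>j. j \<noteq> k0 \<Longrightarrow> j \<noteq> l \<Longrightarrow> x j \<noteq> 0" by blast
    have "l \<noteq> \<sigma> k0"
      using no_point_with_adjacent_zeros[of x k0] zero l other B by blast
    moreover have "k0 \<noteq> \<sigma> l"
      using no_point_with_adjacent_zeros[of x l] zero l other B by blast
    ultimately show ?thesis
      using third_forms_nonadjacent[of x k0 l, OF zero l(2) other l(1)[symmetric] _ _ dB] zero l by blast
  qed
qed

text \<open>Each of the finitely many subspaces from \<open>singular_locus\<close> lies in a
  hyperplane containing the directions V and V'. A translate by z meets that hyperplane only if z
  lies in it, a proper linear condition. The assumption \<open>torus\<close> excludes singular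
  points with all coordinates nonzero.\<close>

theorem generic_plane_section_smooth:
  fixes V V' :: "'n \<Rightarrow> real"
  defines "X \<equiv> \<lambda>(z::real^'n) y1 y2 k. of_real (V k) * y1 + of_real (V' k) * y2 + of_real (z $ k) :: complex"
  assumes torus: "\<And>w :: 'n \<Rightarrow> complex. (\<And>k. w k \<noteq> 0) \<Longrightarrow>
      \<exists>i. of_real (m (\<sigma> i)) * w (\<sigma> (\<sigma> i)) \<noteq> - (of_real (m i) * w i)"
  obtains h where "real_polynomial_function h" "h \<noteq> (\<lambda>_. 0)"
    "\<And>z y1 y2. B (X z y1 y2) = 0 \<Longrightarrow> (\<Sum>k\<in>UNIV. dB k (X z y1 y2) * of_real (V k)) = 0 \<Longrightarrow>
       (\<Sum>k\<in>UNIV. dB k (X z y1 y2) * of_real (V' k)) = 0 \<Longrightarrow> h z = 0"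
proof -
  define T where "T = {(k, l, f). k \<noteq> l \<and> f \<in> third_forms \<and> f $ k = 0 \<and> f $ l = 0 \<and> f \<noteq> 0}"
  define good where "good = (\<lambda>(k, l, f) (c :: real^'n). c \<noteq> 0 \<and> (\<Sum>j\<in>UNIV. c $ j * V j) = 0 \<and> (\<Sum>j\<in>UNIV. c $ j * V' j) = 0 \<and>
    (\<forall>x :: 'n \<Rightarrow> complex. x k = 0 \<longrightarrow> x l = 0 \<longrightarrow> (\<Sum>j\<in>UNIV. of_real (f $ j) * x j) = 0 \<longrightarrow>
      (\<Sum>j\<in>UNIV. of_real (c $ j) * x j) = 0))"
  have "finite third_forms" by (simp add: third_forms_def)
  then have "finite T" by (intro finite_subset[of T "UNIV \<times> UNIV \<times> third_forms"]) (auto simp: T_def)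
  have "\<exists>c. good t c" if "t \<in> T" for t
  proof -
    obtain k l f where t: "t = (k, l, f)" by (cases t)
    with that have "k \<noteq> l" "f $ k = 0" "f $ l = 0" "f \<noteq> 0" by (auto simp: T_def)
    then obtain c :: "real^'n" where "c \<noteq> 0" "(\<Sum>j\<in>UNIV. c $ j * V j) = 0" "(\<Sum>j\<in>UNIV. c $ j * V' j) = 0"
      "\<And>x :: 'n \<Rightarrow> complex. x k = 0 \<Longrightarrow> x l = 0 \<Longrightarrow> (\<Sum>j\<in>UNIV. of_real (f $ j) * x j) = 0 \<Longrightarrow>
        (\<Sum>j\<in>UNIV. of_real (c $ j) * x j) = 0"
      by (rule hyperplane_through_plane[of k l f V V']) blast
    then show ?thesis by (auto simp: good_def t)
  qed
  then obtain c where c: "\<And>t. t \<in> T \<Longrightarrow> good t (c t)" by metis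
  define C where "C = (\<lambda>t z. c t \<bullet> z) ` T"
  show ?thesis
  proof (rule generic_translate_transversal[where B = B and dB = dB and C = C and
        V = "\<lambda>k. of_real (V k)" and V' = "\<lambda>k. of_real (V' k)"])
    show "finite C" using \<open>finite T\<close> by (simp add: C_def)
    show "real_polynomial_function g \<and> g \<noteq> (\<lambda>_. 0)" if "g \<in> C" for g
    proof -
      obtain t where t: "t \<in> T" "g = (\<lambda>z. c t \<bullet> z)" using \<open>g \<in> C\<close> unfolding C_def by blast
      then have "g (c t) \<noteq> 0" using c[of t] by (auto simp: good_def split: prod.splits)
      then have "g \<noteq> (\<lambda>_. 0)" by auto
      moreover have "real_polynomial_function g"
        unfolding t(2) by (intro real_polynomial_function.intros(1) bounded_linear_inner_right)
      ultimately show ?thesis by blast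
    qed
  next
    fix z y1 y2
    let ?x = "\<lambda>k. of_real (V k) * y1 + of_real (V' k) * y2 + complex_of_real (z $ k)"
    assume sing: "B ?x = 0" "\<And>k. dB k ?x = 0"
    have "\<exists>k. ?x k = 0"
    proof (rule ccontr)
      assume "\<nexists>k. ?x k = 0"
      then have nz: "\<And>k. ?x k \<noteq> 0" by blast
      show False
      proof (rule singular_torus[of ?x, OF nz sing])
        fix w :: "'n \<Rightarrow> complex"
        assume "\<And>k. w k \<noteq> 0" "\<And>i. of_real (m (\<sigma> i)) * w (\<sigma> (\<sigma> i)) = - (of_real (m i) * w i)"
        with torus[of w] show False by blast
      qed
    qed
    then obtain k0 where "?x k0 = 0" by blast
    from singular_locus[of ?x, OF sing this] obtain k l f where
      f: "f \<in> third_forms" "k \<noteq> l" "?x k = 0" "?x l = 0" "f $ k = 0" "f $ l = 0" "f \<noteq> 0"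
        "(\<Sum>j\<in>UNIV. of_real (f $ j) * ?x j) = 0" by blast
    define d where "d = c (k, l, f)"
    have T: "(k, l, f) \<in> T" using f by (auto simp: T_def)
    have d: "(\<Sum>j\<in>UNIV. d $ j * V j) = 0" "(\<Sum>j\<in>UNIV. d $ j * V' j) = 0" "(\<Sum>j\<in>UNIV. of_real (d $ j) * ?x j) = 0"
      using c[OF T] f unfolding good_def d_def by auto
    have "(\<Sum>j\<in>UNIV. of_real (d $ j) * ?x j) = of_real (\<Sum>j\<in>UNIV. d $ j * V j) * y1 +
        of_real (\<Sum>j\<in>UNIV. d $ j * V' j) * y2 + complex_of_real (d \<bullet> z)"
      by (simp add: inner_vec_def algebra_simps sum.distrib sum_distrib_left)
    with d have "d \<bullet> z = 0" by simp
    then show "\<exists>c\<in>C. c z = 0" using T by (auto simp: C_def d_def)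
  next
    show "(\<lambda>z. B (\<lambda>k. a k z), \<lambda>z. \<Sum>k\<in>UNIV. dB k (\<lambda>k. a k z) * a' k z) \<in> S"
      if "derivation_graph F S" "\<And>k. (a k, a' k) \<in> S"
      for F S and a :: "'n \<Rightarrow> real^'n \<Rightarrow> complex" and a'
      using that by (rule derivation_graph_cyc_poly)
  next
    fix h assume h: "real_polynomial_function h" "h \<noteq> (\<lambda>_. 0)"
      "\<And>z y1 y2. B (\<lambda>k. of_real (V k) * y1 + of_real (V' k) * y2 + of_real (z $ k)) = 0 \<Longrightarrow>
        (\<Sum>k\<in>UNIV. dB k (\<lambda>k. of_real (V k) * y1 + of_real (V' k) * y2 + of_real (z $ k)) * of_real (V k)) = 0 \<Longrightarrow>
        (\<Sum>k\<in>UNIV. dB k (\<lambda>k. of_real (V k) * y1 + of_real (V' k) * y2 + of_real (z $ k)) * of_real (V' k)) = 0 \<Longrightarrow> h z = 0"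
    show thesis
    proof (rule that[OF h(1,2)])
      fix z y1 y2
      assume "B (X z y1 y2) = 0" "(\<Sum>k\<in>UNIV. dB k (X z y1 y2) * of_real (V k)) = 0"
        "(\<Sum>k\<in>UNIV. dB k (X z y1 y2) * of_real (V' k)) = 0"
      then show "h z = 0" unfolding X_def by (rule h(3))
    qed
  qed
qed

end

section \<open>Relations around a cycle and divisibility by four\<close>

definition next_index :: "nat \<Rightarrow> nat \<Rightarrow> nat" where
  "next_index n i = (if i = n then 1 else i + 1)"

lemma next_index_bij:
  assumes "n > 0"
  shows "bij_betw (next_index n) {1..n} {1..n}"
    and "even n \<Longrightarrow> bij_betw (next_index n) {i\<in>{1..n}. odd i} {i\<in>{1..n}. even i}"
    and "even n \<Longrightarrow> bij_betw (next_index n) {i\<in>{1..n}. even i} {i\<in>{1..n}. odd i}"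
  using assms
  by (auto intro!: bij_betw_byWitness[where f' = "\<lambda>i. if i = 1 then n else i - 1"]
      simp: next_index_def split: if_splits)

text \<open>Multiply the relation over a set S which the successor map carries onto T and back. Two
  steps permute S, so W cancels and \<open>prod a T = (- 1) ^ card S * prod a S\<close>. For odd n
  take S = T to be all indices, for even n the two parity classes; positivity of a decides the
  sign.\<close>

lemma cyclic_recurrence:
  fixes a :: "nat \<Rightarrow> real" and W :: "nat \<Rightarrow> complex"
  assumes n: "n > 0" and a: "\<And>i. a i > 0" and W: "\<And>i. W i \<noteq> 0"
    and rec: "\<And>i. i \<in> {1..n} \<Longrightarrow> of_real (a (next_index n i)) * W (next_index n (next_index n i)) = - (of_real (a i) * W i)"
  shows "4 dvd n" "(\<Prod>i | i \<in> {1..n} \<and> odd i. a i) = (\<Prod>i | i \<in> {1..n} \<and> even i. a i)"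
proof -
  let ?s = "next_index n"
  have prod_rec: "of_real (prod a T) * prod W S = (- 1) ^ card S * (of_real (prod a S) * prod W S)"
    if "bij_betw ?s S T" "bij_betw ?s T S" "S \<subseteq> {1..n}" for S T
  proof -
    have "bij_betw (?s \<circ> ?s) S S" using that by (metis bij_betw_trans)
    then have "prod W S = (\<Prod>i\<in>S. W (?s (?s i)))"
      using prod.reindex_bij_betw[of "?s \<circ> ?s" S S W] by simp
    then have "of_real (prod a T) * prod W S = (\<Prod>i\<in>S. of_real (a (?s i)) * W (?s (?s i)))"
      using prod.reindex_bij_betw[OF that(1), of a] by (simp add: prod.distrib flip: of_real_prod)
    also have "\<dots> = (\<Prod>i\<in>S. - (of_real (a i) * W i))"
      using that(3) rec by (intro prod.cong) auto
    also have "\<dots> = (\<Prod>i\<in>S. - 1 * (of_real (a i) * W i))" by simp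
    also have "\<dots> = (- 1) ^ card S * (of_real (prod a S) * prod W S)"
      unfolding prod.distrib by simp
    finally show ?thesis .
  qed
  have cancel: "prod a T = (- 1) ^ card S * prod a S"
    if "bij_betw ?s S T" "bij_betw ?s T S" "S \<subseteq> {1..n}" for S T
  proof -
    have "prod W S \<noteq> 0" using W by (cases "finite S") auto
    with prod_rec[OF that] have "complex_of_real (prod a T) = of_real ((- 1) ^ card S * prod a S)"
      by (simp add: mult.assoc[symmetric])
    then show ?thesis by (simp only: of_real_eq_iff)
  qed
  have even: "even n"
  proof (rule ccontr)
    assume "odd n"
    then have "prod a {1..n} = - prod a {1..n}"
      using cancel[OF next_index_bij(1)[OF n] next_index_bij(1)[OF n]] by simp
    moreover have "prod a {1..n} > 0" using a by (intro prod_pos) blast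
    ultimately show False by linarith
  qed
  define O' E' where "O' = {i\<in>{1..n}. odd i}" and "E' = {i\<in>{1..n}. even i}"
  have bij: "bij_betw ?s O' E'" "bij_betw ?s E' O'"
    using next_index_bij(2,3)[OF n even] by (auto simp: O'_def E'_def)
  have "{1..n} = O' \<union> E'" "O' \<inter> E' = {}" "finite O'" "finite E'" by (auto simp: O'_def E'_def)
  then have "n = card O' + card E'" by (metis card_Un_disjoint card_atLeastAtMost diff_Suc_1)
  then have n2: "n = 2 * card O'" using bij_betw_same_card[OF bij(1)] by simp
  have eq: "prod a E' = (- 1) ^ card O' * prod a O'"
    by (rule cancel[OF bij]) (auto simp: O'_def)
  have "even (card O')"
  proof (rule ccontr)
    assume "odd (card O')"
    with eq have "prod a E' = - prod a O'" by simp
    moreover have "prod a E' > 0" "prod a O' > 0" using a by (simp_all add: prod_pos)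
    ultimately show False by simp
  qed
  with n2 show "4 dvd n" by (auto elim!: evenE)
  show "(\<Prod>i | i \<in> {1..n} \<and> odd i. a i) = (\<Prod>i | i \<in> {1..n} \<and> even i. a i)"
    using eq \<open>even (card O')\<close> by (simp add: O'_def E'_def)
qed

section \<open>Evaluation of the adjoint\<close>

text \<open>Applied to evaluation at a point and to \<open>complexify\<close>, so that values of the
  adjoint are obtained without expanding it.\<close>

lemma cyc_poly_hom:
  assumes "\<And>a b. h (a + b) = h a + h b" "\<And>a b. h (a * b) = h a * h b" "h 0 = 0" "h 1 = 1"
  shows "h (cyc_poly \<sigma> c x) = cyc_poly \<sigma> (\<lambda>i. h (c i)) (\<lambda>k. h (x k))"
proof -
  have "h (sum f A) = (\<Sum>a\<in>A. h (f a))" if "finite A" for f and A :: "'c set"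
    using that by (induction A) (auto simp: assms)
  moreover have "h (prod f A) = (\<Prod>a\<in>A. h (f a))" if "finite A" for f and A :: "'c set"
    using that by (induction A) (auto simp: assms)
  ultimately show ?thesis by (simp add: cyc_poly_def assms)
qed

lemma dcyc_poly_hom:
  assumes "\<And>a b. h (a + b) = h a + h b" "\<And>a b. h (a * b) = h a * h b" "h 0 = 0" "h 1 = 1"
  shows "h (dcyc_poly \<sigma> c k x) = dcyc_poly \<sigma> (\<lambda>i. h (c i)) k (\<lambda>k. h (x k))"
proof -
  have "h (sum f A) = (\<Sum>a\<in>A. h (f a))" if "finite A" for f and A :: "'c set"
    using that by (induction A) (auto simp: assms)
  moreover have "h (prod f A) = (\<Prod>a\<in>A. h (f a))" if "finite A" for f and A :: "'c set"
    using that by (induction A) (auto simp: assms)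
  ultimately show ?thesis by (simp add: dcyc_poly_def assms)
qed

text \<open>The counterpart of \<open>derivation_graph_cyc_poly\<close> in a ring; applied to the
  two partial derivatives of polynomials in y.\<close>

lemma cyc_poly_derivation:
  fixes \<delta> :: "'a::comm_ring_1 \<Rightarrow> 'a"
  assumes add: "\<And>a b. \<delta> (a + b) = \<delta> a + \<delta> b" and mult: "\<And>a b. \<delta> (a * b) = a * \<delta> b + \<delta> a * b"
    and c: "\<And>i. \<delta> (c i) = 0"
  shows "\<delta> (cyc_poly \<sigma> c x) = (\<Sum>k\<in>UNIV. dcyc_poly \<sigma> c k x * \<delta> (x k))"
proof -
  have 0: "\<delta> 0 = 0" using add[of 0 0] by simp
  have 1: "\<delta> 1 = 0" using mult[of 1 1] by simp
  have sum: "\<delta> (sum f A) = (\<Sum>a\<in>A. \<delta> (f a))" if "finite A" for f and A :: "'b set"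
    using that by (induction A) (auto simp: add 0)
  have prod: "\<delta> (prod f A) = (\<Sum>k\<in>A. prod f (A - {k}) * \<delta> (f k))" if "finite A" for f and A :: "'b set"
    using that
  proof (induction A)
    case empty
    then show ?case by (simp add: 1)
  next
    case (insert i A)
    have "prod f (insert i A - {k}) = f i * prod f (A - {k})" if "k \<in> A" for k
    proof -
      have "insert i A - {k} = insert i (A - {k})" using that insert by auto
      then show ?thesis using insert by simp
    qed
    moreover have "insert i A - {i} = A" using insert by auto
    ultimately show ?case using insert by (simp add: mult sum_distrib_left mult_ac)
  qed
  show ?thesis
    unfolding dcyc_poly_gradient[symmetric] cyc_poly_def
    by (simp add: sum mult c prod)
qed

section \<open>Polynomials in two variables\<close>

lemma eval2_simps [simp]:
  "eval2 (p + q) y = eval2 p y + eval2 q y" "eval2 (p * q) y = eval2 p y * eval2 q y"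
  "eval2 0 y = 0" "eval2 1 y = 1"
  by (simp_all add: eval2_def)

lemma eval2_sum: "eval2 (sum f A) y = (\<Sum>a\<in>A. eval2 (f a) y)"
  by (induction A rule: infinite_finite_induct) auto

lemma map_poly_hom:
  fixes f :: "'a::comm_ring_1 \<Rightarrow> 'b::comm_ring_1"
  assumes "\<And>a b. f (a + b) = f a + f b" "\<And>a b. f (a * b) = f a * f b" "f 0 = 0" "f 1 = 1"
  shows "map_poly f (p + q) = map_poly f p + map_poly f q"
    and "map_poly f (p * q) = map_poly f p * map_poly f q"
    and "map_poly f 0 = 0" and "map_poly f 1 = 1"
proof -
  have sum: "f (sum g A) = (\<Sum>a\<in>A. f (g a))" if "finite A" for g and A :: "nat set"
    using that by (induction A) (auto simp: assms)
  show "map_poly f (p + q) = map_poly f p + map_poly f q"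
    by (simp add: poly_eq_iff coeff_map_poly assms)
  show "map_poly f (p * q) = map_poly f p * map_poly f q"
    by (simp add: poly_eq_iff coeff_map_poly assms coeff_mult sum)
  show "map_poly f 0 = 0" "map_poly f 1 = 1"
    by (simp_all add: one_pCons map_poly_pCons assms)
qed

lemma complexify_hom:
  "complexify (p + q) = complexify p + complexify q" "complexify (p * q) = complexify p * complexify q"
  "complexify 0 = 0" "complexify 1 = 1"
  unfolding complexify_def by (intro map_poly_hom; simp add: map_poly_hom)+

lemma partial1_derivation:
  "partial1 (p + q) = partial1 p + partial1 q"
  "partial1 (p * q) = p * partial1 q + partial1 p * q"
proof -
  have sum: "pderiv (sum f A) = (\<Sum>a\<in>A. pderiv (f a))" if "finite A" for f :: "nat \<Rightarrow> 'a poly" and A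
    using that by (induction A) (auto simp: pderiv_add)
  have mult: "pderiv (a * b) = a * pderiv b + pderiv a * b" for a b :: "'a poly"
    by (simp add: pderiv_mult mult.commute)
  show "partial1 (p + q) = partial1 p + partial1 q"
    by (rule poly_eqI) (simp add: partial1_def coeff_map_poly pderiv_add)
  show "partial1 (p * q) = p * partial1 q + partial1 p * q"
    by (rule poly_eqI) (simp add: partial1_def coeff_map_poly coeff_mult sum mult sum.distrib)
qed

lemma partial2_derivation:
  "partial2 (p + q) = partial2 p + partial2 q"
  "partial2 (p * q) = p * partial2 q + partial2 p * q"
  by (simp_all add: partial2_def pderiv_add pderiv_mult)

text \<open>The affine form a y_1 + b y_2 + c, the outer variable being y_2;
  \<open>lin_poly 0 0 c\<close> serves as the constant c.\<close>

definition lin_poly :: "'a::comm_ring_1 \<Rightarrow> 'a \<Rightarrow> 'a \<Rightarrow> 'a poly poly" where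
  "lin_poly a b c = [:[:c, a:], [:b:]:]"

lemma eval2_lin_poly: "eval2 (lin_poly a b c) y = a * y $ 1 + b * y $ 2 + c"
  by (simp add: eval2_def lin_poly_def algebra_simps)

lemma complexify_lin_poly: "complexify (lin_poly a b c) = lin_poly (of_real a) (of_real b) (of_real c)"
  by (simp add: complexify_def lin_poly_def map_poly_pCons)

lemma partial_lin_poly:
  "partial1 (lin_poly a b c) = lin_poly 0 0 a" "partial2 (lin_poly a b c) = lin_poly 0 0 b"
  by (simp_all add: partial1_def partial2_def lin_poly_def map_poly_pCons pderiv_pCons)

text \<open>The explicit candidate for the adjoint, formed inside the ring of polynomials in y so
  that the statements on homomorphisms and derivations apply to it.\<close>

definition cycle_adjoint :: "('n::finite \<Rightarrow> 'n) \<Rightarrow> ('n \<Rightarrow> real) \<Rightarrow> real^2^'n \<Rightarrow> real^'n \<Rightarrow> real poly poly" where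
  "cycle_adjoint \<sigma> m U z =
    cyc_poly \<sigma> (\<lambda>i. lin_poly 0 0 (m i)) (\<lambda>k. lin_poly (U $ k $ 1) (U $ k $ 2) (z $ k))"

lemma eval2_cycle_adjoint:
  "eval2 (cycle_adjoint \<sigma> m U z) y = cyc_poly \<sigma> m (\<lambda>k. U $ k \<bullet> y + z $ k)"
  unfolding cycle_adjoint_def
  by (subst cyc_poly_hom[of "\<lambda>p. eval2 p y"]) (simp_all add: eval2_lin_poly inner_vec_def sum_2)

text \<open>The partial derivatives of the curve equation are the derivatives of B along the two
  columns of U, which span the plane being translated.\<close>

lemma eval2_complexify_cycle_adjoint:
  fixes y :: "complex^2" and U :: "real^2^'n" and z :: "real^'n" and m :: "'n \<Rightarrow> real"
  defines "x \<equiv> \<lambda>k. of_real (U $ k $ 1) * y $ 1 + of_real (U $ k $ 2) * y $ 2 + of_real (z $ k)"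
    and "c \<equiv> \<lambda>i. complex_of_real (m i)"
  shows "eval2 (complexify (cycle_adjoint \<sigma> m U z)) y = cyc_poly \<sigma> c x"
    and "eval2 (partial1 (complexify (cycle_adjoint \<sigma> m U z))) y =
      (\<Sum>k\<in>UNIV. dcyc_poly \<sigma> c k x * of_real (U $ k $ 1))"
    and "eval2 (partial2 (complexify (cycle_adjoint \<sigma> m U z))) y =
      (\<Sum>k\<in>UNIV. dcyc_poly \<sigma> c k x * of_real (U $ k $ 2))"
proof -
  have *: "complexify (cycle_adjoint \<sigma> m U z) = cyc_poly \<sigma> (\<lambda>i. lin_poly 0 0 (c i))
      (\<lambda>k. lin_poly (of_real (U $ k $ 1)) (of_real (U $ k $ 2)) (of_real (z $ k)))"
    unfolding cycle_adjoint_def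
    by (subst cyc_poly_hom[of complexify]) (simp_all add: complexify_hom complexify_lin_poly c_def)
  have eval: "eval2 (dcyc_poly \<sigma> (\<lambda>i. lin_poly 0 0 (c i)) k
      (\<lambda>k. lin_poly (of_real (U $ k $ 1)) (of_real (U $ k $ 2)) (of_real (z $ k)))) y = dcyc_poly \<sigma> c k x" for k
    by (subst dcyc_poly_hom[of "\<lambda>p. eval2 p y"]) (simp_all add: eval2_lin_poly x_def)
  show "eval2 (complexify (cycle_adjoint \<sigma> m U z)) y = cyc_poly \<sigma> c x"
    unfolding * by (subst cyc_poly_hom[of "\<lambda>p. eval2 p y"]) (simp_all add: eval2_lin_poly x_def)
  have zero: "lin_poly 0 0 0 = (0 :: complex poly poly)" by (simp add: lin_poly_def)
  show "eval2 (partial1 (complexify (cycle_adjoint \<sigma> m U z))) y =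
      (\<Sum>k\<in>UNIV. dcyc_poly \<sigma> c k x * of_real (U $ k $ 1))"
    unfolding * by (subst cyc_poly_derivation[of partial1])
      (simp_all add: partial1_derivation partial_lin_poly zero eval2_sum eval eval2_lin_poly)
  show "eval2 (partial2 (complexify (cycle_adjoint \<sigma> m U z))) y =
      (\<Sum>k\<in>UNIV. dcyc_poly \<sigma> c k x * of_real (U $ k $ 2))"
    unfolding * by (subst cyc_poly_derivation[of partial2])
      (simp_all add: partial2_derivation partial_lin_poly zero eval2_sum eval eval2_lin_poly)
qed

text \<open>The identity theorem, applied twice: for fixed second coordinate the inner polynomial
  has infinitely many roots, and then infinitely many constants are roots of the outer polynomial.
  It gives the uniqueness behind \<open>adjoint_poly\<close>.\<close>

lemma eval2_eqI:
  fixes p q :: "real poly poly"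
  assumes "open S" "y0 \<in> S" and eq: "\<And>y. y \<in> S \<Longrightarrow> eval2 p y = eval2 q y"
  shows "p = q"
proof -
  obtain e where e: "e > 0" "ball y0 e \<subseteq> S" using assms by (auto simp: open_contains_ball)
  have zero: "poly (poly (p - q) [:y0 $ 2 + t:]) (y0 $ 1 + s) = 0"
    if "\<bar>s\<bar> < e / 2" "\<bar>t\<bar> < e / 2" for s t
  proof -
    define y where "y = y0 + s *\<^sub>R axis 1 1 + t *\<^sub>R axis 2 (1::real)"
    have "dist y0 y = norm (y - y0)" by (metis dist_commute dist_norm)
    also have "y - y0 = s *\<^sub>R axis 1 1 + t *\<^sub>R axis 2 1" by (simp add: y_def)
    also have "norm (s *\<^sub>R axis 1 1 + t *\<^sub>R axis 2 (1::real) :: real^2) \<le> \<bar>s\<bar> + \<bar>t\<bar>" by (rule order_trans[OF norm_triangle_ineq]) simp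
    also have "\<dots> < e" using that by simp
    finally have "y \<in> S" using e by auto
    moreover have "y $ 1 = y0 $ 1 + s" "y $ 2 = y0 $ 2 + t"
      by (auto simp: y_def axis_def)
    ultimately show ?thesis using eq[of y] by (simp add: eval2_def)
  qed
  have inf: "infinite {-(e/2)<..<e/2}" using e by simp
  have "poly (p - q) [:y0 $ 2 + t:] = 0" if "\<bar>t\<bar> < e / 2" for t
  proof (rule ccontr)
    assume "poly (p - q) [:y0 $ 2 + t:] \<noteq> 0"
    then have "finite {x. poly (poly (p - q) [:y0 $ 2 + t:]) x = 0}" by (rule poly_roots_finite)
    moreover have "(+) (y0 $ 1) ` {-(e/2)<..<e/2} \<subseteq> {x. poly (poly (p - q) [:y0 $ 2 + t:]) x = 0}"
      using zero that by auto
    ultimately have "finite ((+) (y0 $ 1) ` {-(e/2)<..<e/2})" by (rule rev_finite_subset)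
    with inf show False using finite_imageD inj_on_add by blast
  qed
  then have sub: "(\<lambda>t. [:y0 $ 2 + t:]) ` {-(e/2)<..<e/2} \<subseteq> {x. poly (p - q) x = 0}" by auto
  have "p - q = 0"
  proof (rule ccontr)
    assume "p - q \<noteq> 0"
    then have "finite {x. poly (p - q) x = 0}" by (rule poly_roots_finite)
    with sub have "finite ((\<lambda>t. [:y0 $ 2 + t:]) ` {-(e/2)<..<e/2})" by (metis rev_finite_subset)
    moreover have "inj_on (\<lambda>t. [:y0 $ 2 + t:]) {-(e/2)<..<e/2}" by (simp add: inj_on_def)
    ultimately show False using finite_imageD inf by blast
  qed
  then show ?thesis by simp
qed

section \<open>Complete planar fans\<close>

abbreviation det2 :: "real^2 \<Rightarrow> real^2 \<Rightarrow> real" where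
  "det2 a b \<equiv> a $ 1 * b $ 2 - a $ 2 * b $ 1"

lemma minor_eq: "minor U i j = \<bar>det2 (U $ i) (U $ j)\<bar>"
  by (simp add: minor_def det_2 mult.commute)

lemma convex_cone_hull_singleton:
  "convex_cone hull {a} = {s *\<^sub>R a | s. 0 \<le> s}"
proof
  show "convex_cone hull {a} \<subseteq> {s *\<^sub>R a | s. 0 \<le> s}"
  proof (rule hull_minimal)
    show "{a} \<subseteq> {s *\<^sub>R a | s. 0 \<le> s}" by (auto intro!: exI[of _ 1])
    show "convex_cone {s *\<^sub>R a | s. 0 \<le> s}"
      unfolding convex_cone_iff
    proof (intro conjI ballI allI impI)
      show "0 \<in> {s *\<^sub>R a | s. 0 \<le> s}" by (auto intro!: exI[of _ 0])
      show "x + y \<in> {s *\<^sub>R a | s. 0 \<le> s}" if xy: "x \<in> {s *\<^sub>R a | s. 0 \<le> s}" "y \<in> {s *\<^sub>R a | s. 0 \<le> s}" for x y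
      proof -
        obtain s t where "x = s *\<^sub>R a" "y = t *\<^sub>R a" "0 \<le> s" "0 \<le> t" using xy by blast
        then have "x + y = (s + t) *\<^sub>R a" "0 \<le> s + t" by (auto simp: scaleR_add_left)
        then show ?thesis by blast
      qed
      show "c *\<^sub>R x \<in> {s *\<^sub>R a | s. 0 \<le> s}" if x: "x \<in> {s *\<^sub>R a | s. 0 \<le> s}" "0 \<le> c" for x c
      proof -
        obtain s where "x = s *\<^sub>R a" "0 \<le> s" using x by blast
        then have "c *\<^sub>R x = (c * s) *\<^sub>R a" "0 \<le> c * s" using x(2) by auto
        then show ?thesis by blast
      qed
    qed
  qed
  show "{s *\<^sub>R a | s. 0 \<le> s} \<subseteq> convex_cone hull {a}"
    by (auto intro: convex_cone_hull_mul hull_inc)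
qed

lemma convex_cone_hull_insert2:
  "convex_cone hull {a, b} = {s *\<^sub>R a + t *\<^sub>R b | s t. 0 \<le> s \<and> 0 \<le> t}"
proof -
  have "convex_cone hull ({a} \<union> {b}) = {s *\<^sub>R a + t *\<^sub>R b | s t. 0 \<le> s \<and> 0 \<le> t}"
    unfolding convex_cone_hull_Un convex_cone_hull_singleton by auto
  then show ?thesis by (simp add: insert_commute)
qed

lemma det2_decompose:
  assumes "det2 a b \<noteq> 0"
  obtains s t where "x = s *\<^sub>R a + t *\<^sub>R b"
proof
  have "det2 x b * a $ k + det2 a x * b $ k = x $ k * det2 a b" for k
    using exhaust_2[of k] by (auto simp: algebra_simps)
  then show "x = (det2 x b / det2 a b) *\<^sub>R a + (det2 a x / det2 a b) *\<^sub>R b"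
    using assms by (simp add: vec_eq_iff add_divide_distrib[symmetric])
qed

lemma measure_triangle:
  fixes a b :: "real^2"
  shows "measure lebesgue (convex hull {0, a, b}) = \<bar>det2 a b\<bar> / 2"
proof -
  have "closed (convex hull {0, a, b})"
    by (intro compact_imp_closed finite_imp_compact_convex_hull) auto
  then have "measure lebesgue (convex hull {0, a, b}) = measure lborel (convex hull {0, a, b})"
    by (intro measure_completion) auto
  then show ?thesis by (simp add: content_triangle algebra_simps)
qed

text \<open>What the area computation needs of a normal fan: simplicial cones, each indexed by its
  first generator, covering the plane with negligible overlaps. The signs of the determinants stay
  open, as minors are absolute values.\<close>

locale complete_planar_fan =
  fixes \<Sigma> :: "(real^2) set set" and U :: "real^2^'n" and \<sigma> :: "'n \<Rightarrow> 'n"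
  assumes indep: "det2 (U $ i) (U $ \<sigma> i) \<noteq> 0"
    and cone_mem: "convex_cone hull {U $ i, U $ \<sigma> i} \<in> \<Sigma>"
    and cone_sup: "C \<in> \<Sigma> \<Longrightarrow> \<exists>i. C \<subseteq> convex_cone hull {U $ i, U $ \<sigma> i}"
    and complete: "\<exists>i. x \<in> convex_cone hull {U $ i, U $ \<sigma> i}"
    and overlap: "i \<noteq> j \<Longrightarrow>
      negligible (convex_cone hull {U $ i, U $ \<sigma> i} \<inter> convex_cone hull {U $ j, U $ \<sigma> j})"
begin

abbreviation cone_at :: "'n \<Rightarrow> (real^2) set" where
  "cone_at i \<equiv> convex_cone hull {U $ i, U $ \<sigma> i}"

lemma cone_atE:
  assumes "x \<in> cone_at i"
  obtains s t where "x = s *\<^sub>R U $ i + t *\<^sub>R U $ \<sigma> i" "0 \<le> s" "0 \<le> t"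
  using assms unfolding convex_cone_hull_insert2 by blast

text \<open>The vector representing the linear map which takes the values \<open>z\<^sub>i\<close>, \<open>z\<^bsub>\<sigma> i\<^esub>\<close> at the two
  generators; its negative is a vertex of the polygon.\<close>

definition grad :: "real^'n \<Rightarrow> 'n \<Rightarrow> real^2" where
  "grad z i = (1 / det2 (U $ i) (U $ \<sigma> i)) *\<^sub>R
     vector [z $ i * U $ \<sigma> i $ 2 - z $ \<sigma> i * U $ i $ 2, z $ \<sigma> i * U $ i $ 1 - z $ i * U $ \<sigma> i $ 1]"

lemma grad_inner: "grad z i \<bullet> U $ i = z $ i" "grad z i \<bullet> U $ \<sigma> i = z $ \<sigma> i"
  using indep[of i] by (simp_all add: grad_def inner_vec_def sum_2 vector_2 divide_simps) (simp_all add: algebra_simps)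

text \<open>The gap between z_j and the linear extension of z from cone i; equally, the slack of the
  j-th inequality of the polygon at the vertex \<open>- grad z i\<close>.\<close>

definition slack :: "'n \<Rightarrow> 'n \<Rightarrow> real^'n \<Rightarrow> real" where
  "slack i j z = z $ j - grad z i \<bullet> U $ j"

lemma slack_self [simp]: "slack i i z = 0" "slack i (\<sigma> i) z = 0"
  by (simp_all add: slack_def grad_inner)

text \<open>Convexity means that every linear piece stays below the data at all generators. One
  direction compares along a segment from inside cone i towards generator j, the other takes the
  maximum of the pieces.\<close>

lemma Def_cone_slack: "Def_cone \<Sigma> U = {z. \<forall>i j. slack i j z \<ge> 0}"
proof (intro set_eqI iffI; clarsimp)
  fix z i j
  assume "z \<in> Def_cone \<Sigma> U"
  then obtain \<phi> where lin: "\<And>C. C \<in> \<Sigma> \<Longrightarrow> \<exists>L. linear L \<and> (\<forall>x\<in>C. \<phi> x = L x)"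
    and val: "\<And>i. \<phi> (U $ i) = z $ i" and conv: "convex_on UNIV \<phi>"
    by (auto simp: Def_cone_def)
  obtain L where L: "linear L" "\<And>x. x \<in> cone_at i \<Longrightarrow> \<phi> x = L x" using lin[OF cone_mem] by blast
  have gen: "U $ i \<in> cone_at i" "U $ \<sigma> i \<in> cone_at i" by (auto intro: hull_inc)
  obtain \<alpha> \<beta> where ab: "U $ j = \<alpha> *\<^sub>R U $ i + \<beta> *\<^sub>R U $ \<sigma> i" using det2_decompose[OF indep] by metis
  have LU: "L (U $ j) = grad z i \<bullet> U $ j"
    using L(2)[OF gen(1)] L(2)[OF gen(2)] val
    by (simp add: ab linear_add[OF L(1)] linear_scale[OF L(1)] inner_simps grad_inner)
  \<comment> \<open>Small enough that moving from p towards \<open>U $ j\<close> by the fraction e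
    keeps both coefficients nonnegative, so x remains in the cone where \<phi> is L.\<close>
  define e where "e = 1 / (2 + \<bar>\<alpha>\<bar> + \<bar>\<beta>\<bar>)"
  have e: "0 < e" "e < 1" "e * \<bar>\<alpha>\<bar> + e \<le> 1" "e * \<bar>\<beta>\<bar> + e \<le> 1"
    by (auto simp: e_def field_simps)
  have e': "e * \<alpha> \<ge> - (e * \<bar>\<alpha>\<bar>)" "e * \<beta> \<ge> - (e * \<bar>\<beta>\<bar>)"
    using e(1) by (metis abs_ge_minus_self abs_mult abs_of_pos minus_le_iff)+
  define p where "p = U $ i + U $ \<sigma> i"
  define x where "x = (1 - e) *\<^sub>R p + e *\<^sub>R U $ j"
  have "x = (1 - e + e * \<alpha>) *\<^sub>R U $ i + (1 - e + e * \<beta>) *\<^sub>R U $ \<sigma> i"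
    by (simp add: x_def p_def ab algebra_simps)
  then have x: "x \<in> cone_at i"
    unfolding convex_cone_hull_insert2 using e e' by force
  have p: "p \<in> cone_at i" unfolding p_def by (intro convex_cone_hull_add gen)
  have "L x \<le> (1 - e) * L p + e * \<phi> (U $ j)"
    using convex_onD[OF conv, of e p "U $ j"] e L(2)[OF x] L(2)[OF p] by (simp add: x_def)
  moreover have "L x = (1 - e) * L p + e * L (U $ j)"
    by (simp add: x_def linear_add[OF L(1)] linear_scale[OF L(1)])
  ultimately have "L (U $ j) \<le> \<phi> (U $ j)" using e(1) by simp
  then show "0 \<le> slack i j z" by (simp add: slack_def LU val)
next
  fix z assume sl: "\<forall>i j. 0 \<le> slack i j z"
  \<comment> \<open>On cone i the i-th piece attains the maximum, since pieces need only be compared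
    at the two generators.\<close>
  define \<phi> where "\<phi> x = (MAX i. grad z i \<bullet> x)" for x
  have le: "grad z k \<bullet> x \<le> grad z i \<bullet> x" if x: "x \<in> cone_at i" for x i k
  proof -
    obtain s t where st: "x = s *\<^sub>R U $ i + t *\<^sub>R U $ \<sigma> i" "0 \<le> s" "0 \<le> t" using x by (rule cone_atE)
    have "grad z k \<bullet> U $ i \<le> z $ i" "grad z k \<bullet> U $ \<sigma> i \<le> z $ \<sigma> i"
      using sl by (simp_all add: slack_def)
    then have "s * (grad z k \<bullet> U $ i) + t * (grad z k \<bullet> U $ \<sigma> i) \<le> s * z $ i + t * z $ \<sigma> i"
      using st by (intro add_mono mult_left_mono) auto
    then show ?thesis by (simp add: st inner_simps grad_inner)
  qed
  have \<phi>: "\<phi> x = grad z i \<bullet> x" if "x \<in> cone_at i" for x i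
    unfolding \<phi>_def by (rule Max_eqI) (use le[OF that] in auto)
  have ge: "grad z i \<bullet> x \<le> \<phi> x" for i x
    unfolding \<phi>_def by (rule Max_ge) auto
  show "z \<in> Def_cone \<Sigma> U"
    unfolding Def_cone_def mem_Collect_eq
  proof (rule exI[of _ \<phi>], intro conjI ballI allI)
    fix C assume "C \<in> \<Sigma>"
    then obtain i where "C \<subseteq> cone_at i" using cone_sup by blast
    then have "\<forall>x\<in>C. \<phi> x = grad z i \<bullet> x" using \<phi> by blast
    then show "\<exists>L. linear L \<and> (\<forall>x\<in>C. \<phi> x = L x)"
      by (intro exI[of _ "\<lambda>x. grad z i \<bullet> x"]) (simp add: bounded_linear.linear[OF bounded_linear_inner_right])
  next
    fix i
    show "\<phi> (U $ i) = z $ i" using \<phi>[of "U $ i" i] by (simp add: grad_inner hull_inc)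
  next
    show "convex_on UNIV \<phi>"
    proof (rule convex_onI)
      fix t :: real and x y :: "real^2"
      assume t: "0 < t" "t < 1"
      obtain i where i: "(1 - t) *\<^sub>R x + t *\<^sub>R y \<in> cone_at i" using complete by blast
      have "\<phi> ((1 - t) *\<^sub>R x + t *\<^sub>R y) = (1 - t) * (grad z i \<bullet> x) + t * (grad z i \<bullet> y)"
        using \<phi>[OF i] by (simp add: inner_simps)
      also have "\<dots> \<le> (1 - t) * \<phi> x + t * \<phi> y"
        using t ge by (intro add_mono mult_left_mono) auto
      finally show "\<phi> ((1 - t) *\<^sub>R x + t *\<^sub>R y) \<le> (1 - t) * \<phi> x + t * \<phi> y" .
    qed simp
  qed
qed

lemma slack_eq:
  "slack i j z = z $ j - (z $ i * det2 (U $ j) (U $ \<sigma> i) + z $ \<sigma> i * det2 (U $ i) (U $ j)) / det2 (U $ i) (U $ \<sigma> i)"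
  by (simp add: slack_def grad_def inner_vec_def sum_2 vector_2 divide_simps) (simp add: algebra_simps)

lemma slack_polynomial: "real_polynomial_function (slack i j)"
proof -
  have nth: "real_polynomial_function (\<lambda>z :: real^'n. z $ k)" for k
    by (intro real_polynomial_function.intros(1) bounded_linear_vec_nth)
  show ?thesis
    unfolding slack_eq[abs_def]
    by (intro real_polynomial_function_diff real_polynomial_function_divide
        real_polynomial_function.intros(2-4) nth)
qed

lemma slack_nonzero: "j \<notin> {i, \<sigma> i} \<Longrightarrow> slack i j \<noteq> (\<lambda>_. 0)"
proof
  assume "j \<notin> {i, \<sigma> i}" "slack i j = (\<lambda>_. 0)"
  \<comment> \<open>At \<open>axis j 1\<close> the values at both generators of cone i vanish, so
    the linear extension is zero.\<close>
  then have "slack i j (axis j 1) = 0" "slack i j (axis j 1) = 1"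
    by (simp, subst slack_eq) (auto simp: axis_def)
  then show False by simp
qed

lemma continuous_slack: "continuous_on S (slack i j)"
  using slack_polynomial continuous_on_polymonial_function real_polynomial_function_eq by metis

text \<open>If all the slacks with j \<notin> {i, \<sigma> i} were positive at z, they would be
  positive nearby, and the remaining slacks vanish identically; so z would be an interior
  point.\<close>

lemma frontier_Def_cone:
  assumes "z \<in> frontier (Def_cone \<Sigma> U)"
  shows "\<exists>i j. j \<notin> {i, \<sigma> i} \<and> slack i j z = 0"
proof (rule ccontr)
  assume contr: "\<not> ?thesis"
  have "closed (Def_cone \<Sigma> U)"
    unfolding Def_cone_slack
    by (intro closed_Collect_all closed_Collect_le continuous_intros continuous_slack)
  then have z: "slack i j z \<ge> 0" for i j
    using assms frontier_subset_closed unfolding Def_cone_slack by blast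
  let ?V = "{z. \<forall>i j. j \<notin> {i, \<sigma> i} \<longrightarrow> slack i j z > 0}"
  have "open (\<Inter>i. \<Inter>j\<in>- {i, \<sigma> i}. {z. 0 < slack i j z})"
    by (intro open_INT finite ballI open_Collect_less continuous_intros continuous_slack)
  moreover have "?V = (\<Inter>i. \<Inter>j\<in>- {i, \<sigma> i}. {z. 0 < slack i j z})" by auto
  ultimately have "open ?V" by simp
  moreover have "slack i j z > 0" if "j \<notin> {i, \<sigma> i}" for i j
    using z[of i j] contr that by (metis order_le_less)
  then have "z \<in> ?V" by blast
  moreover have "?V \<subseteq> Def_cone \<Sigma> U"
    unfolding Def_cone_slack by (smt (verit) insert_iff mem_Collect_eq singletonD slack_self subsetI)
  ultimately have "z \<in> interior (Def_cone \<Sigma> U)" by (meson interiorI)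
  with assms show False by (simp add: frontier_def)
qed

section \<open>The polygon, its interior and its polar dual\<close>

lemma vertex_in_polygon:
  assumes "z \<in> Def_cone \<Sigma> U"
  shows "U $ j \<bullet> (- grad z i) + z $ j \<ge> 0"
  using assms unfolding Def_cone_slack by (simp add: slack_def inner_commute)

lemma polygon_iff: "y \<in> polygon U z \<longleftrightarrow> (\<forall>j. U $ j \<bullet> y + z $ j \<ge> 0)"
  by (simp add: polygon_def less_eq_vec_def matrix_vector_mult_def inner_vec_def)

lemma row_nonzero: "U $ i \<noteq> 0"
  using indep[of i] by auto

lemma interior_polygon: "interior (polygon U z) = {y. \<forall>j. U $ j \<bullet> y + z $ j > 0}" (is "_ = ?I")
proof
  have "U $ j \<bullet> y + z $ j > 0" if "y \<in> interior (polygon U z)" for y j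
  proof -
    have "polygon U z \<subseteq> {y. U $ j \<bullet> y \<ge> - z $ j}" by (auto simp: polygon_iff minus_le_iff) (smt (verit))
    then have "y \<in> interior {y. U $ j \<bullet> y \<ge> - z $ j}" using that interior_mono by blast
    then show ?thesis by (simp add: interior_halfspace_ge row_nonzero)
  qed
  then show "interior (polygon U z) \<subseteq> ?I" by blast
  have "open (\<Inter>j. {y. 0 < U $ j \<bullet> y + z $ j})"
    by (intro open_INT finite ballI open_Collect_less continuous_intros)
  moreover have "?I = (\<Inter>j. {y. 0 < U $ j \<bullet> y + z $ j})" by auto
  ultimately have "open ?I" by simp
  then show "?I \<subseteq> interior (polygon U z)"
    by (rule interior_maximal[rotated]) (auto simp: polygon_iff less_imp_le)
qed

text \<open>Lowering every offset by the same small d keeps z in the cone, so the smaller polygon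
  still has a vertex, and there all original forms are at least d. The cone index
  \<open>undefined\<close> is an arbitrary choice of such a vertex.\<close>

lemma interior_polygon_nonempty:
  assumes "z \<in> interior (Def_cone \<Sigma> U)"
  shows "interior (polygon U z) \<noteq> {}"
proof -
  obtain e where e: "e > 0" "cball z e \<subseteq> Def_cone \<Sigma> U"
    using assms mem_interior_cball by blast
  define d where "d = e / norm (1 :: real^'n)"
  have n1: "norm (1 :: real^'n) > 0" by simp
  then have "d > 0" using e by (simp add: d_def)
  define z' where "z' = z - d *\<^sub>R 1"
  have "z' \<in> cball z e" using e by (simp add: z'_def dist_norm d_def)
  then have "z' \<in> Def_cone \<Sigma> U" using e by blast
  from vertex_in_polygon[OF this] have "- grad z' undefined \<in> interior (polygon U z)"
    unfolding interior_polygon using \<open>d > 0\<close> by (auto simp: z'_def algebra_simps) (smt (verit))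
  then show ?thesis by blast
qed

text \<open>Within cone i the inequality at the vertex \<open>- grad z i\<close> cuts off exactly
  the triangle; conversely, nonnegative combinations of the inequalities for two generators bound
  every point of the triangle.\<close>

lemma polar_dual_polygon:
  assumes z: "z \<in> Def_cone \<Sigma> U" and y: "y \<in> interior (polygon U z)"
  defines "l \<equiv> \<lambda>j. U $ j \<bullet> y + z $ j"
  shows "polar_dual ((\<lambda>x. x - y) ` polygon U z) =
    (\<Union>i. convex hull {0, (1 / l i) *\<^sub>R U $ i, (1 / l (\<sigma> i)) *\<^sub>R U $ \<sigma> i})"
proof -
  have l: "l j > 0" for j using y by (simp add: interior_polygon l_def)
  have tri: "convex hull {0, (1 / l i) *\<^sub>R U $ i, (1 / l (\<sigma> i)) *\<^sub>R U $ \<sigma> i} =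
      {s *\<^sub>R U $ i + t *\<^sub>R U $ \<sigma> i | s t. 0 \<le> s \<and> 0 \<le> t \<and> s * l i + t * l (\<sigma> i) \<le> 1}" for i
  proof (intro set_eqI iffI)
    fix x assume "x \<in> convex hull {0, (1 / l i) *\<^sub>R U $ i, (1 / l (\<sigma> i)) *\<^sub>R U $ \<sigma> i}"
    then obtain u v w where "0 \<le> u" "0 \<le> v" "0 \<le> w" "u + v + w = 1"
      "x = (v / l i) *\<^sub>R U $ i + (w / l (\<sigma> i)) *\<^sub>R U $ \<sigma> i"
      by (auto simp: convex_hull_3)
    then show "x \<in> {s *\<^sub>R U $ i + t *\<^sub>R U $ \<sigma> i | s t. 0 \<le> s \<and> 0 \<le> t \<and> s * l i + t * l (\<sigma> i) \<le> 1}"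
      using l[of i] l[of "\<sigma> i"] by (intro CollectI exI[of _ "v / l i"] exI[of _ "w / l (\<sigma> i)"]) auto
  next
    fix x assume "x \<in> {s *\<^sub>R U $ i + t *\<^sub>R U $ \<sigma> i | s t. 0 \<le> s \<and> 0 \<le> t \<and> s * l i + t * l (\<sigma> i) \<le> 1}"
    then obtain s t where "0 \<le> s" "0 \<le> t" "s * l i + t * l (\<sigma> i) \<le> 1" "x = s *\<^sub>R U $ i + t *\<^sub>R U $ \<sigma> i"
      by blast
    then show "x \<in> convex hull {0, (1 / l i) *\<^sub>R U $ i, (1 / l (\<sigma> i)) *\<^sub>R U $ \<sigma> i}"
      using l[of i] l[of "\<sigma> i"] unfolding convex_hull_3
      by (intro CollectI exI[of _ "1 - (s * l i + t * l (\<sigma> i))"] exI[of _ "s * l i"] exI[of _ "t * l (\<sigma> i)"]) auto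
  qed
  show ?thesis
  proof (intro set_eqI iffI)
    fix u assume u: "u \<in> polar_dual ((\<lambda>x. x - y) ` polygon U z)"
    obtain i where "u \<in> cone_at i" using complete by blast
    then obtain s t where st: "u = s *\<^sub>R U $ i + t *\<^sub>R U $ \<sigma> i" "0 \<le> s" "0 \<le> t" by (rule cone_atE)
    have "- grad z i \<in> polygon U z" using vertex_in_polygon[OF z] polygon_iff by blast
    then have "u \<bullet> (- grad z i - y) \<ge> -1" using u by (auto simp: polar_dual_def)
    moreover have "U $ i \<bullet> grad z i = z $ i" "U $ \<sigma> i \<bullet> grad z i = z $ \<sigma> i"
      using grad_inner by (simp_all add: inner_commute)
    ultimately have "s * l i + t * l (\<sigma> i) \<le> 1"
      by (simp add: st inner_simps l_def algebra_simps)
    with st show "u \<in> (\<Union>i. convex hull {0, (1 / l i) *\<^sub>R U $ i, (1 / l (\<sigma> i)) *\<^sub>R U $ \<sigma> i})"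
      unfolding tri by blast
  next
    fix u assume "u \<in> (\<Union>i. convex hull {0, (1 / l i) *\<^sub>R U $ i, (1 / l (\<sigma> i)) *\<^sub>R U $ \<sigma> i})"
    then obtain i s t where st: "u = s *\<^sub>R U $ i + t *\<^sub>R U $ \<sigma> i" "0 \<le> s" "0 \<le> t" "s * l i + t * l (\<sigma> i) \<le> 1"
      unfolding tri by blast
    have "u \<bullet> (x - y) \<ge> -1" if "x \<in> polygon U z" for x
    proof -
      have "U $ j \<bullet> (x - y) \<ge> - l j" for j
        using that by (simp add: polygon_iff l_def inner_simps) (smt (verit))
      then have "s * (U $ i \<bullet> (x - y)) + t * (U $ \<sigma> i \<bullet> (x - y)) \<ge> s * (- l i) + t * (- l (\<sigma> i))"
        using st by (intro add_mono mult_left_mono) auto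
      moreover have "u \<bullet> (x - y) = s * (U $ i \<bullet> (x - y)) + t * (U $ \<sigma> i \<bullet> (x - y))"
        by (simp add: st inner_add_left)
      ultimately show ?thesis using st(4) by linarith
    qed
    then show "u \<in> polar_dual ((\<lambda>x. x - y) ` polygon U z)" by (auto simp: polar_dual_def)
  qed
qed

text \<open>The triangles lie in different cones, so their overlaps are negligible and the areas
  add; the factor 2! cancels the 1/2 in the area of a triangle.\<close>

lemma Vol_polar_dual:
  assumes z: "z \<in> Def_cone \<Sigma> U" and y: "y \<in> interior (polygon U z)"
  defines "l \<equiv> \<lambda>j. U $ j \<bullet> y + z $ j"
  shows "Vol (polar_dual ((\<lambda>x. x - y) ` polygon U z)) = (\<Sum>i\<in>UNIV. minor U i (\<sigma> i) / (l i * l (\<sigma> i)))"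
proof -
  have l: "l j > 0" for j using y by (simp add: interior_polygon l_def)
  let ?T = "\<lambda>i. convex hull {0, (1 / l i) *\<^sub>R U $ i, (1 / l (\<sigma> i)) *\<^sub>R U $ \<sigma> i}"
  have sub: "?T i \<subseteq> cone_at i" for i
  proof (rule hull_minimal)
    have "(1 / l k) *\<^sub>R U $ k \<in> cone_at i" if "k \<in> {i, \<sigma> i}" for k
      by (rule convex_cone_hull_mul) (use that l[of k] in \<open>auto intro: hull_inc\<close>)
    then show "{0, (1 / l i) *\<^sub>R U $ i, (1 / l (\<sigma> i)) *\<^sub>R U $ \<sigma> i} \<subseteq> cone_at i"
      by (simp add: convex_cone_hull_contains_0)
  qed (rule convex_convex_cone_hull)
  have "measure lebesgue (\<Union>i. ?T i) = (\<Sum>i\<in>UNIV. measure lebesgue (?T i))"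
  proof (rule measure_negligible_finite_Union_image)
    show "?T i \<in> lmeasurable" for i
      by (intro lmeasurable_compact finite_imp_compact_convex_hull) auto
    show "pairwise (\<lambda>i j. negligible (?T i \<inter> ?T j)) UNIV"
    proof (rule pairwiseI)
      fix i j :: 'n assume "i \<noteq> j"
      from overlap[OF this] show "negligible (?T i \<inter> ?T j)"
        by (rule negligible_subset) (use sub in blast)
    qed
  qed auto
  also have "\<dots> = (\<Sum>i\<in>UNIV. minor U i (\<sigma> i) / (l i * l (\<sigma> i)) / 2)"
  proof (intro sum.cong refl)
    fix i
    have "det2 ((1 / l i) *\<^sub>R U $ i) ((1 / l (\<sigma> i)) *\<^sub>R U $ \<sigma> i) = det2 (U $ i) (U $ \<sigma> i) / (l i * l (\<sigma> i))"
      using l[of i] l[of "\<sigma> i"] by (simp add: field_simps)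
    then show "measure lebesgue (?T i) = minor U i (\<sigma> i) / (l i * l (\<sigma> i)) / 2"
      unfolding measure_triangle minor_eq using l[of i] l[of "\<sigma> i"] by (simp add: abs_mult)
  qed
  also have "\<dots> = (\<Sum>i\<in>UNIV. minor U i (\<sigma> i) / (l i * l (\<sigma> i))) / 2"
    by (simp only: sum_divide_distrib)
  finally show ?thesis
    unfolding Vol_def polar_dual_polygon[OF z y] l_def by (simp add: fact_2)
qed

end

section \<open>Normal fans of polygons\<close>

lemma face_of_polytope_vertex:
  fixes Q :: "'a::euclidean_space set"
  assumes "polytope Q" "F face_of Q" "F \<noteq> {}"
  obtains v where "v \<in> F" "v extreme_point_of Q"
proof -
  have "polytope F" using assms face_of_polytope_polytope by blast
  then have "F = convex hull {x. x extreme_point_of F}"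
    by (intro Krein_Milman_Minkowski polytope_imp_compact polytope_imp_convex)
  with assms(3) have "{x. x extreme_point_of F} \<noteq> {}" by (metis convex_hull_empty)
  then obtain v where "v extreme_point_of F" by blast
  then show ?thesis using that assms(2) extreme_point_of_face[OF assms(2)] by blast
qed

lemma normal_cone_vertex_mem:
  "v extreme_point_of Q \<Longrightarrow> inner_normal_cone Q {v} \<in> normal_fan Q"
  unfolding normal_fan_def by (auto simp: face_of_singleton intro!: exI[of _ "{v}"])

lemma normal_cone_subset_vertex:
  assumes "polytope Q" "C \<in> normal_fan Q"
  obtains v where "v extreme_point_of Q" "C \<subseteq> inner_normal_cone Q {v}"
proof -
  obtain F where F: "C = inner_normal_cone Q F" "F face_of Q" "F \<noteq> {}"
    using assms(2) by (auto simp: normal_fan_def)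
  obtain v where "v \<in> F" "v extreme_point_of Q"
    using face_of_polytope_vertex[OF assms(1) F(2,3)] by blast
  then show ?thesis using that F(1) by (auto simp: inner_normal_cone_def)
qed

text \<open>The functional u attains its minimum over Q on a nonempty face, and that face contains a
  vertex.\<close>

lemma normal_fan_complete:
  assumes "polytope Q" "Q \<noteq> {}"
  obtains v where "v extreme_point_of Q" "u \<in> inner_normal_cone Q {v}"
proof -
  obtain x where x: "x \<in> Q" "\<And>y. y \<in> Q \<Longrightarrow> u \<bullet> x \<le> u \<bullet> y"
  proof -
    have "continuous_on Q (\<lambda>y. u \<bullet> y)" by (intro continuous_intros)
    from continuous_attains_inf[OF polytope_imp_compact[OF assms(1)] assms(2) this] that
    show ?thesis by blast
  qed
  let ?F = "Q \<inter> {y. u \<bullet> y = u \<bullet> x}"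
  have "?F face_of Q"
    by (rule face_of_Int_supporting_hyperplane_ge) (use x polytope_imp_convex[OF assms(1)] in auto)
  moreover have "?F \<noteq> {}" using x(1) by blast
  ultimately obtain v where "v \<in> ?F" "v extreme_point_of Q"
    using face_of_polytope_vertex[OF assms(1)] by blast
  then show ?thesis using that x(2) by (auto simp: inner_normal_cone_def)
qed

lemma finite_normal_fan: "polytope Q \<Longrightarrow> finite (normal_fan Q)"
proof -
  assume "polytope Q"
  then have "finite (inner_normal_cone Q ` {F. F face_of Q})" by (simp add: finite_polytope_faces)
  then show ?thesis by (rule rev_finite_subset) (auto simp: normal_fan_def)
qed

lemma maximal_cone_above:
  assumes "polytope Q" "C \<in> normal_fan Q"
  obtains D where "D \<in> maximal_cones (normal_fan Q)" "C \<subseteq> D"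
proof -
  obtain D where "D \<in> normal_fan Q" "C \<subseteq> D" "\<forall>E\<in>normal_fan Q. D \<subseteq> E \<longrightarrow> D = E"
    using finite_has_maximal2[OF finite_normal_fan[OF assms(1)] assms(2)] by blast
  then show ?thesis using that by (auto simp: maximal_cones_def)
qed

text \<open>\<open>cyclic_order\<close> speaks of maximal cones only; this ties them to vertices of
  Q, where their geometry is visible.\<close>

lemma maximal_cone_vertex:
  assumes "polytope Q" "D \<in> maximal_cones (normal_fan Q)"
  obtains v where "v extreme_point_of Q" "D = inner_normal_cone Q {v}"
proof -
  have D: "D \<in> normal_fan Q" "\<And>E. E \<in> normal_fan Q \<Longrightarrow> D \<subseteq> E \<Longrightarrow> D = E"
    using assms(2) by (auto simp: maximal_cones_def)
  obtain v where "v extreme_point_of Q" "D \<subseteq> inner_normal_cone Q {v}"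
    using normal_cone_subset_vertex[OF assms(1) D(1)] .
  then show ?thesis using that D(2) normal_cone_vertex_mem by blast
qed

text \<open>A functional minimal at both v and w is orthogonal to v - w, which is nonzero because
  the cones differ.\<close>

lemma distinct_normal_cones_overlap:
  assumes "inner_normal_cone Q {v} \<noteq> inner_normal_cone Q {w}" "v \<in> Q" "w \<in> Q"
  shows "negligible (inner_normal_cone Q {v} \<inter> inner_normal_cone Q {w})"
proof -
  have "negligible {x. (v - w) \<bullet> x = 0}"
    by (rule negligible_hyperplane) (use assms(1) in auto)
  moreover have "inner_normal_cone Q {v} \<inter> inner_normal_cone Q {w} \<subseteq> {x. (v - w) \<bullet> x = 0}"
  proof
    fix x assume "x \<in> inner_normal_cone Q {v} \<inter> inner_normal_cone Q {w}"
    then have "x \<bullet> v \<le> x \<bullet> w" "x \<bullet> w \<le> x \<bullet> v" using assms(2,3) by (auto simp: inner_normal_cone_def)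
    then show "x \<in> {x. (v - w) \<bullet> x = 0}" by (simp add: inner_diff_left inner_commute[of _ x])
  qed
  ultimately show ?thesis by (rule negligible_subset)
qed

lemma convex_gon_card:
  assumes "convex_gon n Q"
  shows "n \<ge> 3"
proof -
  let ?V = "{v. v extreme_point_of Q}"
  have Q: "polytope Q" "aff_dim Q = 2" "card ?V = n" using assms by (auto simp: convex_gon_def)
  have "finite ?V" using Q(1) finite_polyhedron_extreme_points polytope_imp_polyhedron by blast
  moreover have "Q = convex hull ?V" 
    using Q(1) by (intro Krein_Milman_Minkowski polytope_imp_compact polytope_imp_convex)
  ultimately show ?thesis using aff_dim_le_card[of ?V] aff_dim_convex_hull[of ?V] Q by simp
qed

section \<open>Rays and maximal cones in cyclic order\<close>

definition cyclic_succ :: "nat \<Rightarrow> (nat \<Rightarrow> 'n) \<Rightarrow> 'n \<Rightarrow> 'n" where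
  "cyclic_succ n r k = r (next_index n (the_inv_into {1..n} r k))"

lemma cyclic_succ:
  assumes r: "bij_betw r {1..n} UNIV" and n: "n \<ge> 3"
  shows "i \<in> {1..n} \<Longrightarrow> cyclic_succ n r (r i) = r (next_index n i)"
    and "bij (cyclic_succ n r)" "cyclic_succ n r k \<noteq> k" "cyclic_succ n r (cyclic_succ n r k) \<noteq> k"
proof -
  have inj: "inj_on r {1..n}" using r by (rule bij_betw_imp_inj_on)
  show eq: "cyclic_succ n r (r i) = r (next_index n i)" if "i \<in> {1..n}" for i
    unfolding cyclic_succ_def using the_inv_into_f_f[OF inj that] by simp
  have next_mem: "next_index n i \<in> {1..n}" if "i \<in> {1..n}" for i using that n by (auto simp: next_index_def)
  have "bij_betw (r \<circ> next_index n \<circ> the_inv_into {1..n} r) UNIV UNIV"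
    using bij_betw_the_inv_into[OF r] next_index_bij(1)[of n] r n by (auto intro: bij_betw_trans)
  then show "bij (cyclic_succ n r)"
    by (simp add: cyclic_succ_def[abs_def] comp_def)
  have "k \<in> r ` {1..n}" using bij_betw_imp_surj_on[OF r] by simp
  then obtain i where i: "i \<in> {1..n}" "k = r i" by blast
  have "next_index n i \<noteq> i" "next_index n (next_index n i) \<noteq> i"
    using n i(1) by (auto simp: next_index_def)
  then show "cyclic_succ n r k \<noteq> k" "cyclic_succ n r (cyclic_succ n r k) \<noteq> k"
    using inj_onD[OF inj] i(1) next_mem by (metis eq i(2))+
qed

lemma same_ray:
  assumes "ray_matrix \<Sigma> U" "U $ i = c *\<^sub>R U $ j" "c > 0"
  shows "i = j"
proof -
  have sub: "convex_cone hull {s *\<^sub>R a} \<subseteq> convex_cone hull {a}" if "s > 0" for s and a :: "real^2"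
    by (rule hull_minimal)
      (use that in \<open>auto intro: convex_cone_hull_mul hull_inc convex_cone_convex_cone_hull\<close>)
  have "U $ j = (1 / c) *\<^sub>R U $ i" using assms by simp
  then have "convex_cone hull {U $ i} = convex_cone hull {U $ j}"
    using sub[of c "U $ j"] sub[of "1 / c" "U $ i"] assms(2,3) by auto
  moreover have "inj (\<lambda>i. convex_cone hull {U $ i})"
    using assms(1) by (auto simp: ray_matrix_def bij_betw_def)
  ultimately show ?thesis by (auto dest: injD)
qed

text \<open>Expressing each pair by the other gives two nonnegative 2 x 2 matrices inverse to each
  other. The vanishing off-diagonal sums force zero entries, so both matrices are a permutation
  times a positive diagonal.\<close>

lemma cone_generators_unique:
  fixes a b c d :: "real^2"
  assumes indep: "det2 a b \<noteq> 0" "det2 c d \<noteq> 0"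
    and eq: "convex_cone hull {a, b} = convex_cone hull {c, d}"
  obtains (same) s t where "a = s *\<^sub>R c" "s > 0" "b = t *\<^sub>R d" "t > 0"
    | (swap) s t where "a = s *\<^sub>R d" "s > 0" "b = t *\<^sub>R c" "t > 0"
proof -
  have mem: "a \<in> convex_cone hull {c, d}" "b \<in> convex_cone hull {c, d}"
    "c \<in> convex_cone hull {a, b}" "d \<in> convex_cone hull {a, b}"
    using hull_inc[of _ "{a, b}" convex_cone] hull_inc[of _ "{c, d}" convex_cone] eq by auto
  obtain a1 a2 where a: "a = a1 *\<^sub>R c + a2 *\<^sub>R d" "0 \<le> a1" "0 \<le> a2"
    using mem(1) unfolding convex_cone_hull_insert2 by blast
  obtain b1 b2 where b: "b = b1 *\<^sub>R c + b2 *\<^sub>R d" "0 \<le> b1" "0 \<le> b2"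
    using mem(2) unfolding convex_cone_hull_insert2 by blast
  obtain c1 c2 where c: "c = c1 *\<^sub>R a + c2 *\<^sub>R b" "0 \<le> c1" "0 \<le> c2"
    using mem(3) unfolding convex_cone_hull_insert2 by blast
  obtain d1 d2 where d: "d = d1 *\<^sub>R a + d2 *\<^sub>R b" "0 \<le> d1" "0 \<le> d2"
    using mem(4) unfolding convex_cone_hull_insert2 by blast
  have ind: "x = 0 \<and> y = 0" if "x *\<^sub>R c + y *\<^sub>R d = 0" for x y
  proof -
    have "x * c $ k + y * d $ k = 0" for k using arg_cong[OF that, of "\<lambda>v. v $ k"] by simp
    from this[of 1] this[of 2] have "x * det2 c d = 0" "y * det2 c d = 0" by algebra+
    then show ?thesis using indep(2) by simp
  qed
  have "(c1 * a1 + c2 * b1 - 1) *\<^sub>R c + (c1 * a2 + c2 * b2) *\<^sub>R d = 0"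
    using c(1) unfolding a(1) b(1) by (simp add: algebra_simps)
  from ind[OF this] have 1: "c1 * a1 + c2 * b1 = 1" "c1 * a2 + c2 * b2 = 0" by auto
  have "(d1 * a1 + d2 * b1) *\<^sub>R c + (d1 * a2 + d2 * b2 - 1) *\<^sub>R d = 0"
    using d(1) unfolding a(1) b(1) by (simp add: algebra_simps)
  from ind[OF this] have 2: "d1 * a1 + d2 * b1 = 0" "d1 * a2 + d2 * b2 = 1" by auto
  have 3: "c1 * a2 = 0" "c2 * b2 = 0" "d1 * a1 = 0" "d2 * b1 = 0"
    using 1(2) 2(1) a(2,3) b(2,3) c(2,3) d(2,3) by (simp_all add: add_nonneg_eq_0_iff)
  show ?thesis
  proof (cases "c1 = 0")
    case True
    then have "b1 \<noteq> 0" "c2 \<noteq> 0" using 1 by auto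
    then have "b2 = 0" "d2 = 0" using 3 by auto
    then have "a2 \<noteq> 0" "d1 \<noteq> 0" using 2 by auto
    then have "a1 = 0" using 3 by auto
    show ?thesis
      by (rule swap[of a2 b1]) (use a b \<open>a1 = 0\<close> \<open>b2 = 0\<close> \<open>a2 \<noteq> 0\<close> \<open>b1 \<noteq> 0\<close> in auto)
  next
    case False
    then have "a2 = 0" using 3 by auto
    then have "d2 \<noteq> 0" "b2 \<noteq> 0" using 2 by auto
    then have "b1 = 0" using 3 by auto
    then have "a1 \<noteq> 0" using 1 by auto
    show ?thesis
      by (rule same[of a1 b2]) (use a b \<open>b1 = 0\<close> \<open>a2 = 0\<close> \<open>b2 \<noteq> 0\<close> \<open>a1 \<noteq> 0\<close> in auto)
  qed
qed

lemma maximal_cones_cyclic_succ: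
  fixes U :: "real^2^'n"
  assumes "cyclic_order \<Sigma> U r" and n: "n = CARD('n)" "n \<ge> 3"
  shows "maximal_cones \<Sigma> = range (\<lambda>i. convex_cone hull {U $ i, U $ cyclic_succ n r i})"
proof -
  let ?\<sigma> = "cyclic_succ n r"
  have r: "bij_betw r {1..n} UNIV" using assms by (auto simp: cyclic_order_def)
  have "range (\<lambda>i. convex_cone hull {U $ i, U $ ?\<sigma> i}) =
      (\<lambda>i. convex_cone hull {U $ r i, U $ ?\<sigma> (r i)}) ` {1..n}"
    unfolding bij_betw_imp_surj_on[OF r, symmetric] image_image ..
  also have "\<dots> = (\<lambda>i. convex_cone hull {U $ r i, U $ r (next_index n i)}) ` {1..n}"
    by (intro image_cong refl) (simp add: cyclic_succ(1)[OF r n(2)])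
  also have "{1..n} = insert n {1..<n}" using n by auto
  also have "(\<lambda>i. convex_cone hull {U $ r i, U $ r (next_index n i)}) ` insert n {1..<n} =
     {convex_cone hull {U $ r i, U $ r (i + 1)} | i. i \<in> {1..<n}} \<union> {convex_cone hull {U $ r 1, U $ r n}}"
  proof -
    have "(\<lambda>i. convex_cone hull {U $ r i, U $ r (next_index n i)}) ` {1..<n} =
        (\<lambda>i. convex_cone hull {U $ r i, U $ r (i + 1)}) ` {1..<n}"
      by (intro image_cong refl) (simp add: next_index_def)
    \<comment> \<open>The closing pair 1, n of the ordering is n together with its
      successor.\<close>
    moreover have "convex_cone hull {U $ r n, U $ r (next_index n n)} = convex_cone hull {U $ r 1, U $ r n}"
      by (simp add: next_index_def insert_commute)
    ultimately show ?thesis unfolding Setcompr_eq_image image_insert by auto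
  qed
  finally show ?thesis using assms by (auto simp: cyclic_order_def)
qed

lemma polygon_normal_fan:
  fixes U :: "real^2^'n"
  assumes gon: "convex_gon n Q" and fan: "\<Sigma> = normal_fan Q" and rays: "ray_matrix \<Sigma> U"
    and order: "cyclic_order \<Sigma> U r" and n: "n = CARD('n)"
  shows "complete_planar_fan \<Sigma> U (cyclic_succ n r)"
proof -
  let ?\<sigma> = "cyclic_succ n r"
  let ?C = "\<lambda>i. convex_cone hull {U $ i, U $ ?\<sigma> i}"
  have Q: "polytope Q" "aff_dim Q = 2" using gon by (auto simp: convex_gon_def)
  have "Q \<noteq> {}" using Q by auto
  have n3: "n \<ge> 3" using gon by (rule convex_gon_card)
  have r: "bij_betw r {1..n} UNIV" using order n by (auto simp: cyclic_order_def)
  note succ = cyclic_succ[OF r n3]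
  have max: "maximal_cones \<Sigma> = range ?C" by (rule maximal_cones_cyclic_succ[OF order n n3])
  have indep: "det2 (U $ i) (U $ ?\<sigma> i) \<noteq> 0" for i
  proof
    assume det: "det2 (U $ i) (U $ ?\<sigma> i) = 0"
    have nz: "U $ i \<noteq> 0" "U $ ?\<sigma> i \<noteq> 0" using rays by (auto simp: ray_matrix_def)
    obtain c where c: "U $ ?\<sigma> i = c *\<^sub>R U $ i"
    proof (cases "U $ i $ 1 = 0")
      case True
      then have "U $ i $ 2 \<noteq> 0" using nz(1) by (auto simp: vec_eq_iff forall_2)
      with det True show ?thesis
        by (intro that[of "U $ ?\<sigma> i $ 2 / U $ i $ 2"]) (auto simp: vec_eq_iff forall_2)
    next
      case False
      with det show ?thesis
        by (intro that[of "U $ ?\<sigma> i $ 1 / U $ i $ 1"]) (auto simp: vec_eq_iff forall_2 field_simps)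
    qed
    have "c \<noteq> 0"
    proof
      assume "c = 0"
      with c nz(2) show False by (simp only: scaleR_zero_left)
    qed
    moreover have "\<not> c > 0" using same_ray[OF rays c] succ(3) by blast
    ultimately have "c < 0" by simp
    have "?C i \<in> maximal_cones (normal_fan Q)" using max fan by blast
    then obtain v where v: "?C i = inner_normal_cone Q {v}"
      by (rule maximal_cone_vertex[OF Q(1)])
    \<comment> \<open>The normal cone of a vertex would contain opposite vectors, so
      \<open>U $ i\<close> would be constant on Q and Q would lie in a line.\<close>
    have "U $ i \<in> ?C i" "c *\<^sub>R U $ i \<in> ?C i" unfolding c[symmetric] by (auto intro: hull_inc)
    then have "U $ i \<bullet> v \<le> U $ i \<bullet> y" "c * (U $ i \<bullet> v) \<le> c * (U $ i \<bullet> y)" if "y \<in> Q" for y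
      using that unfolding v by (auto simp: inner_normal_cone_def)
    then have "Q \<subseteq> {y. U $ i \<bullet> y = U $ i \<bullet> v}"
      using \<open>c < 0\<close> by (auto simp: mult_le_cancel_left_neg intro: antisym)
    then have "aff_dim Q \<le> aff_dim {y. U $ i \<bullet> y = U $ i \<bullet> v}" by (rule aff_dim_subset)
    then show False using Q nz by (simp add: aff_dim_hyperplane)
  qed
  have mem: "?C i \<in> maximal_cones (normal_fan Q)" for i using max fan by simp
  have above: "\<exists>i. C \<subseteq> ?C i" if C: "C \<in> normal_fan Q" for C
  proof -
    obtain D where "D \<in> maximal_cones (normal_fan Q)" "C \<subseteq> D" by (rule maximal_cone_above[OF Q(1) C])
    then show ?thesis using max fan by auto
  qed
  show ?thesis
  proof
    show "det2 (U $ i) (U $ ?\<sigma> i) \<noteq> 0" for i by (rule indep)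
    show "?C i \<in> \<Sigma>" for i
      using mem[of i] by (simp add: maximal_cones_def fan)
    show "\<exists>i. C \<subseteq> ?C i" if "C \<in> \<Sigma>" for C
      using above that fan by simp
    show "\<exists>i. x \<in> ?C i" for x
    proof -
      obtain v where v: "v extreme_point_of Q" "x \<in> inner_normal_cone Q {v}"
        by (rule normal_fan_complete[OF Q(1) \<open>Q \<noteq> {}\<close>])
      then show ?thesis using above[OF normal_cone_vertex_mem[OF v(1)]] by blast
    qed
    show "negligible (?C i \<inter> ?C j)" if "i \<noteq> j" for i j
    proof -
      have ne: "?C i \<noteq> ?C j"
      proof
        assume "?C i = ?C j"
        with indep indep show False
        proof (cases rule: cone_generators_unique)
          case (same s t)
          then show False using same_ray[OF rays same(1,2)] \<open>i \<noteq> j\<close> by simp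
        next
          \<comment> \<open>Swapped generators would make i and j successors of each other, a cycle
            of length two, while n is at least three.\<close>
          case (swap s t)
          then have "i = ?\<sigma> j" "?\<sigma> i = j"
            using same_ray[OF rays swap(1,2)] same_ray[OF rays swap(3,4)] by simp_all
          then show False using succ(4)[of j] by simp
        qed
      qed
      obtain v where v: "v extreme_point_of Q" "?C i = inner_normal_cone Q {v}"
        by (rule maximal_cone_vertex[OF Q(1) mem])
      obtain w where w: "w extreme_point_of Q" "?C j = inner_normal_cone Q {w}"
        by (rule maximal_cone_vertex[OF Q(1) mem])
      have "v \<in> Q" "w \<in> Q" using v(1) w(1) by (simp_all add: extreme_point_of_def)
      then show ?thesis
        using ne unfolding v(2) w(2) by (intro distinct_normal_cones_overlap)
    qed
  qed
qed

section \<open>Smoothness of the adjoint curve\<close>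

context complete_planar_fan
begin

text \<open>Clearing denominators in the volume formula shows that the candidate has the defining
  property; the interior of the polygon is open and nonempty, so the identity theorem makes it the
  only one.\<close>

lemma adjoint_poly_eq:
  assumes "z \<in> interior (Def_cone \<Sigma> U)"
  shows "adjoint_poly U z = cycle_adjoint \<sigma> (\<lambda>i. minor U i (\<sigma> i)) U z" (is "_ = ?A")
proof -
  have z: "z \<in> Def_cone \<Sigma> U" using assms interior_subset by blast
  obtain y0 where y0: "y0 \<in> interior (polygon U z)" using interior_polygon_nonempty[OF assms] by blast
  have ne: "\<sigma> i \<noteq> i" for i using indep[of i] by auto
  have Vol: "Vol (polar_dual ((\<lambda>x. x - y) ` polygon U z)) =
      eval2 ?A y / (\<Prod>i\<in>UNIV. U $ i \<bullet> y + z $ i)" and pos: "(\<Prod>i\<in>UNIV. U $ i \<bullet> y + z $ i) > 0"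
    if y: "y \<in> interior (polygon U z)" for y
  proof -
    define l where "l j = U $ j \<bullet> y + z $ j" for j
    have l: "l j > 0" for j using y by (simp add: interior_polygon l_def)
    show P: "(\<Prod>i\<in>UNIV. U $ i \<bullet> y + z $ i) > 0"
      using l by (simp add: prod_pos l_def)
    have "(\<Prod>j\<in>UNIV - {i, \<sigma> i}. l j) / (\<Prod>j\<in>UNIV. l j) = 1 / (l i * l (\<sigma> i))" for i
    proof -
      have "(\<Prod>j\<in>UNIV. l j) = (\<Prod>j\<in>UNIV - {i, \<sigma> i}. l j) * (\<Prod>j\<in>{i, \<sigma> i}. l j)"
        by (rule prod.subset_diff) auto
      moreover have "l j \<noteq> 0" for j using l[of j] by simp
      ultimately show ?thesis using ne[of i] by simp
    qed
    then have "minor U i (\<sigma> i) * (\<Prod>j\<in>UNIV - {i, \<sigma> i}. l j) / (\<Prod>j\<in>UNIV. l j) =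
        minor U i (\<sigma> i) / (l i * l (\<sigma> i))" for i
      by (metis times_divide_eq_right mult.right_neutral)
    then show "Vol (polar_dual ((\<lambda>x. x - y) ` polygon U z)) =
        eval2 ?A y / (\<Prod>i\<in>UNIV. U $ i \<bullet> y + z $ i)"
      unfolding Vol_polar_dual[OF z y] eval2_cycle_adjoint cyc_poly_def sum_divide_distrib l_def
      by simp
  qed
  show ?thesis
    unfolding adjoint_poly_def
  proof (rule the_equality)
    show "\<forall>y\<in>interior (polygon U z). Vol (polar_dual ((\<lambda>x. x - y) ` polygon U z)) =
        eval2 ?A y / (\<Prod>i\<in>UNIV. U $ i \<bullet> y + z $ i)" using Vol by blast
  next
    fix p assume p: "\<forall>y\<in>interior (polygon U z). Vol (polar_dual ((\<lambda>x. x - y) ` polygon U z)) =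
        eval2 p y / (\<Prod>i\<in>UNIV. U $ i \<bullet> y + z $ i)"
    have "eval2 p y = eval2 ?A y" if y: "y \<in> interior (polygon U z)" for y
    proof -
      have "eval2 p y / (\<Prod>i\<in>UNIV. U $ i \<bullet> y + z $ i) = eval2 ?A y / (\<Prod>i\<in>UNIV. U $ i \<bullet> y + z $ i)"
        using p Vol[OF y] y by simp
      moreover have "(\<Prod>i\<in>UNIV. U $ i \<bullet> y + z $ i) \<noteq> 0" using pos[OF y] by linarith
      ultimately show ?thesis unfolding divide_cancel_right by blast
    qed
    then show "p = ?A" by (rule eval2_eqI[OF open_interior y0])
  qed
qed

end

lemma real_polynomial_function_prod_nonzero:
  fixes f :: "'i \<Rightarrow> 'a::real_normed_vector \<Rightarrow> real"
  assumes "finite I" "\<And>i. i \<in> I \<Longrightarrow> real_polynomial_function (f i) \<and> f i \<noteq> (\<lambda>_. 0)"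
  shows "\<exists>z. (\<Prod>i\<in>I. f i z) \<noteq> 0"
  using assms
proof (induction I)
  case (insert i I)
  obtain a where "f i a \<noteq> 0" using insert.prems by (auto simp: fun_eq_iff)
  moreover obtain b where "(\<Prod>i\<in>I. f i b) \<noteq> 0" using insert by auto
  moreover have "real_polynomial_function (\<lambda>z. \<Prod>i\<in>I. f i z)"
    using insert by (intro real_polynomial_function_prod) auto
  ultimately have "\<exists>z. f i z * (\<Prod>i\<in>I. f i z) \<noteq> 0"
    using insert.prems by (intro real_polynomial_function_mult_nonzero) auto
  then show ?case using insert.hyps by simp
qed auto

theorem corollary7p14:
  fixes Q :: "(real^2) set" and \<Sigma> :: "(real^2) set set"
    and U :: "real^2^'n" and r :: "nat \<Rightarrow> 'n" and n :: nat
    and u :: "nat \<Rightarrow> nat \<Rightarrow> real"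
  assumes n: "n = CARD('n)"
    and gon: "convex_gon n Q"
    and fan: "\<Sigma> = normal_fan Q"
    and rays: "ray_matrix \<Sigma> U"
    and order: "cyclic_order \<Sigma> U r"
    and u: "\<And>i j. u i j = minor U (r i) (r j)"
    and hyp: "\<not> 4 dvd n \<or>
      (\<Prod>i | i \<in> {1..<n} \<and> odd i. u i (i + 1)) \<noteq>
        u 1 n * (\<Prod>i | i \<in> {1..<n} \<and> even i. u i (i + 1))"
  shows "generic_in_Def \<Sigma> U (\<lambda>z. smooth_curve (adjoint_poly U z))"
proof -
  define \<sigma> where "\<sigma> = cyclic_succ n r"
  define m where "m i = minor U i (\<sigma> i)" for i
  have n3: "n \<ge> 3" using gon by (rule convex_gon_card)
  have r: "bij_betw r {1..n} UNIV" using order n by (auto simp: cyclic_order_def)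
  note succ = cyclic_succ[OF r n3, folded \<sigma>_def]
  interpret complete_planar_fan \<Sigma> U \<sigma>
    unfolding \<sigma>_def using gon fan rays order n by (rule polygon_normal_fan)
  interpret weighted_cycle \<sigma> m
    using succ indep by unfold_locales (simp_all add: m_def minor_eq)
  have torus: "\<exists>i. of_real (m (\<sigma> i)) * w (\<sigma> (\<sigma> i)) \<noteq> - (of_real (m i) * w i)"
    if w: "\<And>k. w k \<noteq> 0" for w :: "'n \<Rightarrow> complex"
  proof (rule ccontr)
    assume "\<not> ?thesis"
    then have rec: "of_real (m (\<sigma> i)) * w (\<sigma> (\<sigma> i)) = - (of_real (m i) * w i)" for i by blast
    have next_mem: "next_index n i \<in> {1..n}" if "i \<in> {1..n}" for i using that n3 by (auto simp: next_index_def)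
    have rec': "of_real (m (r (next_index n i))) * w (r (next_index n (next_index n i))) =
        - (of_real (m (r i)) * w (r i))" if "i \<in> {1..n}" for i
      using rec[of "r i"] succ(1)[OF that] succ(1)[OF next_mem[OF that]] by simp
    have "n > 0" using n3 by simp
    note cyc = cyclic_recurrence[of n "\<lambda>i. m (r i)" "\<lambda>i. w (r i)", OF \<open>n > 0\<close> pos w rec']
    have mu: "m (r i) = u i (i + 1)" if "i \<in> {1..<n}" for i
      using that succ(1)[of i] by (simp add: m_def u next_index_def)
    \<comment> \<open>The pair appears as n, 1 on the left and as 1, n on the right; the absolute
      value ignores the order.\<close>
    have mn: "m (r n) = u 1 n"
      using succ(1)[of n] n3 by (simp add: m_def u next_index_def minor_eq mult.commute)
    have "even n" using cyc(1) by (meson dvd_trans even_numeral)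
    then have odd_set: "{i. i \<in> {1..n} \<and> odd i} = {i. i \<in> {1..<n} \<and> odd i}"
      by (auto simp: order_less_le)
    \<comment> \<open>For even n the index n lies in the even class and contributes the closing
      minor \<open>u 1 n\<close>.\<close>
    have even_set: "{i. i \<in> {1..n} \<and> even i} = insert n {i. i \<in> {1..<n} \<and> even i}"
      using \<open>even n\<close> n3 by auto
    have "(\<Prod>i | i \<in> {1..<n} \<and> odd i. u i (i + 1)) = (\<Prod>i | i \<in> {1..n} \<and> odd i. m (r i))"
      unfolding odd_set by (intro prod.cong refl mu[symmetric]) simp
    also have "\<dots> = (\<Prod>i | i \<in> {1..n} \<and> even i. m (r i))" by (rule cyc(2))
    also have "\<dots> = m (r n) * (\<Prod>i | i \<in> {1..<n} \<and> even i. m (r i))"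
      unfolding even_set by (rule prod.insert) auto
    also have "(\<Prod>i | i \<in> {1..<n} \<and> even i. m (r i)) = (\<Prod>i | i \<in> {1..<n} \<and> even i. u i (i + 1))"
      by (intro prod.cong refl mu) simp
    finally show False using hyp cyc(1) mn by simp
  qed
  obtain h where h: "real_polynomial_function h" "h \<noteq> (\<lambda>_. 0)"
    and smooth: "\<And>z y1 y2. B (\<lambda>k. of_real (U $ k $ 1) * y1 + of_real (U $ k $ 2) * y2 + of_real (z $ k)) = 0 \<Longrightarrow>
      (\<Sum>k\<in>UNIV. dB k (\<lambda>k. of_real (U $ k $ 1) * y1 + of_real (U $ k $ 2) * y2 + of_real (z $ k)) * of_real (U $ k $ 1)) = 0 \<Longrightarrow>
      (\<Sum>k\<in>UNIV. dB k (\<lambda>k. of_real (U $ k $ 1) * y1 + of_real (U $ k $ 2) * y2 + of_real (z $ k)) * of_real (U $ k $ 2)) = 0 \<Longrightarrow> h z = 0"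
    using generic_plane_section_smooth[of "\<lambda>k. U $ k $ 1" "\<lambda>k. U $ k $ 2", OF torus] by blast
  \<comment> \<open>The slack factors put the boundary of the deformation cone into the exceptional
    hypersurface. J leaves out the slacks that vanish identically, which keeps the product
    nonzero.\<close>
  define J where "J = {(i, j). j \<notin> {i, \<sigma> i}}"
  define f where "f z = h z * (\<Prod>(i, j)\<in>J. slack i j z)" for z
  have J: "real_polynomial_function ((\<lambda>(i, j). slack i j) t) \<and> (\<lambda>(i, j). slack i j) t \<noteq> (\<lambda>_. 0)"
    if "t \<in> J" for t
    using that slack_polynomial slack_nonzero by (auto simp: J_def)
  have slack_prod: "real_polynomial_function (\<lambda>z. \<Prod>(i, j)\<in>J. slack i j z)"
    by (intro real_polynomial_function_prod) (auto simp: slack_polynomial)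
  have "\<exists>z. (\<Prod>(i, j)\<in>J. slack i j z) \<noteq> 0"
    using real_polynomial_function_prod_nonzero[OF finite J] by (simp add: case_prod_beta)
  then obtain b where b: "(\<Prod>(i, j)\<in>J. slack i j b) \<noteq> 0" by blast
  obtain a where a: "h a \<noteq> 0" using h(2) by (auto simp: fun_eq_iff)
  have f: "real_polynomial_function f" "\<exists>z. f z \<noteq> 0"
    unfolding f_def using h(1) slack_prod real_polynomial_function_mult_nonzero[OF h(1) a slack_prod b]
    by (auto intro: real_polynomial_function.intros(4))
  show ?thesis
    unfolding generic_in_Def_def
  proof (intro exI[of _ "{z. f z = 0}"] conjI ballI)
    show "zariski_closed {z. f z = 0}"
      unfolding zariski_closed_def by (rule exI[of _ "{f}"]) (use f in auto)
    show "{z. f z = 0} \<noteq> UNIV" using f(2) by auto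
    show "frontier (Def_cone \<Sigma> U) \<subseteq> {z. f z = 0}"
    proof
      fix z assume "z \<in> frontier (Def_cone \<Sigma> U)"
      then obtain i j where "(i, j) \<in> J" "slack i j z = 0"
        using frontier_Def_cone[of z] unfolding J_def by blast
      then have "(\<Prod>(i, j)\<in>J. slack i j z) = 0" by (intro prod_zero bexI[of _ "(i, j)"]) simp_all
      then show "z \<in> {z. f z = 0}" by (simp add: f_def)
    qed
    fix z assume z: "z \<in> Def_cone \<Sigma> U - {z. f z = 0}"
    then have "h z \<noteq> 0" by (auto simp: f_def)
    have "z \<notin> frontier (Def_cone \<Sigma> U)"
      using z \<open>frontier (Def_cone \<Sigma> U) \<subseteq> {z. f z = 0}\<close> by blast
    then have "z \<in> interior (Def_cone \<Sigma> U)"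
      using z closure_subset by (auto simp: frontier_def)
    from adjoint_poly_eq[OF this] have "adjoint_poly U z = cycle_adjoint \<sigma> m U z"
      by (simp add: m_def[abs_def])
    then show "smooth_curve (adjoint_poly U z)"
      unfolding smooth_curve_def using smooth \<open>h z \<noteq> 0\<close>
      by (auto simp: eval2_complexify_cycle_adjoint)
  qed
qed

end
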